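(* Fix an integer $N>0$ and $N$-tuples $\mathbf{m}=(m_0,\dots,m_{N-1})$, $\mathbf{n}=(n_0,\dots,n_{N-1})$ of real numbers, each tuple having pairwise distinct coordinates. Consider, for a vector $\mathbf{u}$ with positive coordinates, the inequality $$( * )\qquad \frac{|\det (\mathbf{u}^{\circ m_0} | \dots | \mathbf{u}^{\circ m_{N-1}})|}{|V(\mathbf{m})|} \geqslant \frac{|\det (\mathbf{u}^{\circ n_0} | \dots | \mathbf{u}^{\circ n_{N-1}})|}{|V(\mathbf{n})|}.$$ Then the following are equivalent. (1) Inequality $( * )$ holds for all $\mathbf{u} \in (0,+\infty)^N$. (2) The tuple $\mathbf{m}$ majorizes $\mathbf{n}$. (3) Inequality $( * )$ holds for all $\mathbf{u} \in (0,1)^N \cup (1,+\infty)^N$. In fact, in (3) one only needs to work with a certain countable set of vectors: if $I_\infty$ is any non-empty deleted neighborhood of $+\infty$ in $[1,+\infty)$ and $I_0$ is any non-empty deleted neighborhood of $0$ in $(0,1]$, then there is a countable set $S \subset (I_0)^N \cup (I_\infty)^N$ such that (1) and (2) are equivalent to $( * )$ holding for all $\mathbf{u} \in S$.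
   Context: For $\mathbf{u}=(u_1,\dots,u_N)^T$ with positive coordinates and real $\alpha$, $\mathbf{u}^{\circ \alpha} := (u_1^\alpha,\dots,u_N^\alpha)^T$; $(\mathbf{u}^{\circ m_0} | \dots | \mathbf{u}^{\circ m_{N-1}})$ is the $N\times N$ matrix with these columns. For a tuple $(t_0,\dots,t_{N-1})$, $V(t_0,\dots,t_{N-1}) := \prod_{0 \leqslant i < j \leqslant N-1} (t_j - t_i)$. For real $N$-tuples, let $x_{[1]} \geqslant \cdots \geqslant x_{[N]}$ denote the decreasing rearrangement of the coordinates of $\mathbf{x}$; then $\mathbf{x}$ majorizes $\mathbf{y}$ if $\sum_{j=1}^k x_{[j]} \geqslant \sum_{j=1}^k y_{[j]}$ for all $0 < k < N$ and $\sum_{j=1}^N x_{[j]} = \sum_{j=1}^N y_{[j]}$. A deleted neighborhood of $+\infty$ in $[1,+\infty)$ is essentially a set of the form $(K,+\infty)$ or $[K,+\infty)$ with $K \geqslant 1$ real; similarly a deleted neighborhood of $0$ in $(0,1]$ is essentially a set of the form $(0,\delta)$ or $(0,\delta]$ with $0<\delta\leqslant 1$. *)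

theory Defs
  imports "Jordan_Normal_Form.Determinant" "HOL-Library.Countable_Set"
begin

definition hadamard_powr :: "real vec \<Rightarrow> real \<Rightarrow> real vec" where
  "hadamard_powr u a = map_vec (\<lambda>x. x powr a) u"

definition gen_vandermonde_mat :: "real vec \<Rightarrow> real vec \<Rightarrow> real mat" where
  "gen_vandermonde_mat u m = mat_of_cols (dim_vec u) (map (hadamard_powr u) (list_of_vec m))"

definition vandermonde :: "real vec \<Rightarrow> real" where
  "vandermonde t = (\<Prod>(i, j) \<in> {(i, j). i < j \<and> j < dim_vec t}. t $ j - t $ i)"

text \<open>\<open>decr_entry x j\<close> is the entry $x_{[j]}$ of the decreasing rearrangement; \<open>j\<close> runs from 1 to
  the dimension of \<open>x\<close>.\<close>

definition decr_entry :: "real vec \<Rightarrow> nat \<Rightarrow> real" where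
  "decr_entry x j = rev (sort (list_of_vec x)) ! (j - 1)"

definition majorizes :: "real vec \<Rightarrow> real vec \<Rightarrow> bool" where
  "majorizes x y \<longleftrightarrow> dim_vec x = dim_vec y \<and>
     (\<forall>k. 0 < k \<and> k < dim_vec x \<longrightarrow>
        (\<Sum>j = 1..k. decr_entry x j) \<ge> (\<Sum>j = 1..k. decr_entry y j)) \<and>
     (\<Sum>j = 1..dim_vec x. decr_entry x j) = (\<Sum>j = 1..dim_vec x. decr_entry y j)"

definition vdm_ratio_ineq :: "real vec \<Rightarrow> real vec \<Rightarrow> real vec \<Rightarrow> bool" where
  "vdm_ratio_ineq m n u \<longleftrightarrow>
     \<bar>det (gen_vandermonde_mat u m)\<bar> / \<bar>vandermonde m\<bar>
       \<ge> \<bar>det (gen_vandermonde_mat u n)\<bar> / \<bar>vandermonde n\<bar>"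

text \<open>The Cartesian power $I^N$ as a set of vectors.\<close>

definition vec_cube :: "real set \<Rightarrow> nat \<Rightarrow> real vec set" where
  "vec_cube I N = {u \<in> carrier_vec N. \<forall>i < N. u $ i \<in> I}"

definition deleted_nbhd_infinity :: "real set \<Rightarrow> bool" where
  "deleted_nbhd_infinity I \<longleftrightarrow> (\<exists>K \<ge> 1. I = {K<..} \<or> I = {K..})"

definition deleted_nbhd_zero :: "real set \<Rightarrow> bool" where
  "deleted_nbhd_zero I \<longleftrightarrow> (\<exists>\<delta>. 0 < \<delta> \<and> \<delta> \<le> 1 \<and> (I = {0<..<\<delta>} \<or> I = {0<..\<delta>}))"

definition distinct_tuples :: "nat \<Rightarrow> real vec set" where
  "distinct_tuples N = {m \<in> carrier_vec N. \<forall>i < N. \<forall>j < N. i \<noteq> j \<longrightarrow> m $ i \<noteq> m $ j}"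

end

theory Submission
  imports Defs
begin

text \<open>
  Why majorization implies the inequality. Only absolute values occur, so \<open>m\<close> and \<open>n\<close> may be sorted
  decreasingly. Write \<open>V\<close> for the Vandermonde product and \<open>D(u; m)\<close> for the determinant. The claim
  is that \<open>D(u; m) / V(m)\<close> is Schur-convex in \<open>m\<close>. The usual argument represents this ratio as an
  integral over the unitary group; here it is obtained instead from a random walk.

  Let \<open>m\<close> be an integer tuple, thought of as \<open>N\<close> particles on a line. The operator \<open>A\<close> that sums a function
  over the \<open>N\<close> unit shifts of \<open>m\<close> satisfies \<open>A V = N V\<close>. Hence \<open>f \<mapsto> A (V f) / V\<close> averages \<open>f\<close>, up to the
  factor \<open>N\<close>, over one step of a random walk in which particle \<open>i\<close> moves with weight
  \<open>\<Prod>j \<noteq> i. 1 + 1 / (m i - m j)\<close> and particles never collide (\<open>sum_jump_weight\<close>,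
  \<open>step_sum_pow_walk_step\<close>). Two facts about this walk carry the proof.

  First, the walk respects majorization (\<open>walk_step_isotone\<close>): it maps nonnegative functions that
  increase under majorization to such functions. The danger lies at an index \<open>k\<close> where the sums of the
  \<open>k\<close> largest entries of \<open>m\<close> and \<open>n\<close> agree. There the probability that one of the first \<open>k\<close> particles
  moves must be at least as large for \<open>m\<close> as for \<open>n\<close>, and it is, because this probability is itself
  Schur-convex in each of the two groups of particles (\<open>weight_partial_sum_mono\<close>); this comes down to
  the convexity of \<open>ln (t + 1) - ln t\<close>.

  Second, start from the permanent \<open>h\<close> of the matrix \<open>u i powr m j\<close>, a convex symmetric function of \<open>m\<close>
  and therefore increasing under majorization (\<open>perm_sum_isotone\<close>). Powers of \<open>A\<close> on exponentials times
  polynomials have explicit asymptotics, and \<open>A^T (V h) / (W^T T^d)\<close> tends to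
  \<open>V(u) D(u; m) / W^d\<close>, where \<open>W\<close> is the sum of the \<open>u i\<close> and \<open>d\<close> the degree of \<open>V\<close>
  (\<open>step_sum_pow_vprod_perm_sum\<close>). So \<open>V(u) D(u; m) / V(m)\<close> is a limit of nonnegative functions
  that increase under majorization. Rounding the partial sums of real tuples to a grid extends
  this from integers to real exponents (\<open>abs_ratio_mono\<close>).

  Why the inequality on a small set implies majorization. For \<open>u i = B powr (l * r i)\<close> with \<open>B > 1\<close>, with \<open>r\<close>
  strictly decreasing and \<open>l\<close> tending to infinity, the determinant grows like \<open>B\<close> to the power
  \<open>l * (\<Sum>i. r i * m i)\<close> (\<open>alternant_geometric_asymptotics\<close>). The inequality along such a sequence
  therefore compares these linear forms for \<open>m\<close> and \<open>n\<close>. Letting \<open>r\<close> weigh the first \<open>k\<close> coordinates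
  more and more heavily gives the inequalities between partial sums, with \<open>u\<close> near infinity; negative
  \<open>r\<close>, with \<open>u\<close> near zero, gives the reverse inequality of the totals. Countably many \<open>u\<close> are used,
  and they are the same for all \<open>m\<close> and \<open>n\<close> (\<open>ex_countable_test_set\<close>).
\<close>

section \<open>Summation by parts and majorization\<close>

lemma sum_mult_by_partial_sums:
  fixes g d :: "nat \<Rightarrow> real"
  shows "(\<Sum>i<N. g i * d i) =
    g (N - 1) * sum d {..<N} + (\<Sum>k\<in>{1..<N}. (g (k - 1) - g k) * sum d {..<k})"
proof (induction N)
  case (Suc N)
  then show ?case
    by (cases "N = 0") (simp_all add: sum.atLeastLessThan_Suc algebra_simps)
qed simp

text \<open>The form in which majorization is used throughout: with \<open>d = m - n\<close> the partial sums of \<open>d\<close> are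
  nonnegative, so a decreasing \<open>g\<close> suffices. The hypothesis speaks of the product so that \<open>g\<close> need
  only decrease at those \<open>k\<close> where the partial sum of \<open>d\<close> does not vanish, and the sign of the
  partial sum matters only where \<open>g\<close> drops.\<close>

lemma sum_mult_nonneg_by_partial_sums:
  fixes g d :: "nat \<Rightarrow> real"
  assumes "\<And>k. 0 < k \<Longrightarrow> k < N \<Longrightarrow> 0 \<le> (g (k - 1) - g k) * sum d {..<k}"
    and "sum d {..<N} = 0"
  shows "0 \<le> (\<Sum>i<N. g i * d i)"
  unfolding sum_mult_by_partial_sums using assms by (auto intro!: sum_nonneg)

text \<open>Majorization of two tuples whose first \<open>N\<close> entries are already in decreasing order; it is then
  a system of linear inequalities, and all work is done on sorted tuples for this reason.\<close>

definition dominates :: "nat \<Rightarrow> (nat \<Rightarrow> real) \<Rightarrow> (nat \<Rightarrow> real) \<Rightarrow> bool" where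
  "dominates N m n \<longleftrightarrow>
     (\<forall>k<N. sum n {..<k} \<le> sum m {..<k}) \<and> sum n {..<N} = sum m {..<N}"

lemma tangent_below_of_mono_deriv:
  fixes f f' :: "real \<Rightarrow> real"
  assumes S: "\<And>x y z. x \<in> S \<Longrightarrow> y \<in> S \<Longrightarrow> x \<le> z \<Longrightarrow> z \<le> y \<Longrightarrow> z \<in> S"
    and der: "\<And>t. t \<in> S \<Longrightarrow> (f has_real_derivative f' t) (at t)"
    and mono: "\<And>s t. s \<in> S \<Longrightarrow> t \<in> S \<Longrightarrow> s \<le> t \<Longrightarrow> f' s \<le> f' t"
    and x: "x \<in> S" and y: "y \<in> S"
  shows "f' y * (x - y) \<le> f x - f y"
proof -
  consider "x = y" | "x < y" | "y < x" by linarith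
  then show ?thesis
  proof cases
    case 2
    obtain z where z: "x < z" "z < y" "f y - f x = (y - x) * f' z"
      using MVT2[of x y f f'] 2 S[OF x y] der by auto
    have "f' z \<le> f' y" using mono S[OF x y] z y by simp
    then have "(y - x) * f' z \<le> (y - x) * f' y" using 2 by (intro mult_left_mono) auto
    then show ?thesis using z by (simp add: algebra_simps)
  next
    case 3
    obtain z where z: "y < z" "z < x" "f x - f y = (x - y) * f' z"
      using MVT2[of y x f f'] 3 S[OF y x] der by auto
    have "f' y \<le> f' z" using mono S[OF y x] z y by simp
    then have "(x - y) * f' y \<le> (x - y) * f' z" using 3 by (intro mult_left_mono) auto
    then show ?thesis using z by (simp add: algebra_simps)
  qed auto
qed

text \<open>Bound each \<open>f (m i) - f (n i)\<close> below by the tangent of \<open>f\<close> at \<open>n i\<close>. The slopes decrease with \<open>i\<close>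
  because \<open>n\<close> does and \<open>f\<close> is convex, so summation by parts applies.\<close>

lemma karamata:
  fixes f f' :: "real \<Rightarrow> real"
  assumes S: "\<And>x y z. x \<in> S \<Longrightarrow> y \<in> S \<Longrightarrow> x \<le> z \<Longrightarrow> z \<le> y \<Longrightarrow> z \<in> S"
    and der: "\<And>t. t \<in> S \<Longrightarrow> (f has_real_derivative f' t) (at t)"
    and mono: "\<And>s t. s \<in> S \<Longrightarrow> t \<in> S \<Longrightarrow> s \<le> t \<Longrightarrow> f' s \<le> f' t"
    and mS: "\<And>i. i < N \<Longrightarrow> m i \<in> S" and nS: "\<And>i. i < N \<Longrightarrow> n i \<in> S"
    and dec: "\<And>i j. i < j \<Longrightarrow> j < N \<Longrightarrow> n j \<le> n i"
    and dom: "dominates N m n"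
  shows "(\<Sum>i<N. f (n i)) \<le> (\<Sum>i<N. f (m i))"
proof -
  have "0 \<le> (\<Sum>i<N. f' (n i) * (m i - n i))"
  proof (rule sum_mult_nonneg_by_partial_sums)
    fix k assume k: "0 < k" "k < N"
    have "f' (n k) \<le> f' (n (k - 1))"
      using k by (intro mono nS dec) auto
    moreover have "0 \<le> (\<Sum>i<k. m i - n i)"
      using dom k by (simp add: dominates_def sum_subtractf)
    ultimately show "0 \<le> (f' (n (k - 1)) - f' (n k)) * (\<Sum>i<k. m i - n i)" by simp
  qed (use dom in \<open>simp add: dominates_def sum_subtractf\<close>)
  also have "\<dots> \<le> (\<Sum>i<N. f (m i) - f (n i))"
    by (intro sum_mono tangent_below_of_mono_deriv[of S, OF S der mono]) (auto intro: mS nS)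
  finally show ?thesis by (simp add: sum_subtractf)
qed

section \<open>The weights of a random walk on strictly decreasing lattice tuples\<close>

text \<open>For \<open>I = {..<N}\<close> this is the ratio of the Vandermonde products after and before \<open>m i\<close> is raised by
  one, that is, \<open>N\<close> times the probability that walker \<open>i\<close> moves when \<open>N\<close> walkers are conditioned never
  to collide. General index sets \<open>I\<close> allow the tuple to be cut into two blocks.\<close>

definition jump_weight :: "'a set \<Rightarrow> ('a \<Rightarrow> real) \<Rightarrow> 'a \<Rightarrow> real" where
  "jump_weight I m i = (\<Prod>j\<in>I - {i}. 1 + 1 / (m i - m j))"

lemma jump_weight_insert:
  assumes "finite I" "y \<notin> I" "i \<in> I"
  shows "jump_weight (insert y I) m i = (1 + 1 / (m i - m y)) * jump_weight I m i"
proof -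
  have "insert y I - {i} = insert y (I - {i})" using assms by auto
  then show ?thesis using assms by (simp add: jump_weight_def)
qed

lemma jump_weight_insert_new:
  assumes "y \<notin> I"
  shows "jump_weight (insert y I) m y = (\<Prod>i\<in>I. 1 + 1 / (m y - m i))"
  using assms by (simp add: jump_weight_def)

text \<open>The weights are the residues of a rational function. In the induction the new pole \<open>m y\<close> has the
  residue that the hypothesis at \<open>z = m y\<close> predicts, and the other residues change by the factor of
  \<open>jump_weight_insert\<close>.\<close>

lemma jump_weight_partial_fractions:
  assumes "finite I" "inj_on m I" "z \<notin> m ` I"
  shows "(\<Prod>i\<in>I. 1 + 1 / (z - m i)) = 1 + (\<Sum>i\<in>I. jump_weight I m i / (z - m i))"
  using assms
proof (induction I arbitrary: z rule: finite_induct)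
  case (insert y I)
  let ?c = "jump_weight I m"
  have IHz: "(\<Prod>i\<in>I. 1 + 1 / (z - m i)) = 1 + (\<Sum>i\<in>I. ?c i / (z - m i))"
    and IHy: "(\<Prod>i\<in>I. 1 + 1 / (m y - m i)) = 1 + (\<Sum>i\<in>I. ?c i / (m y - m i))"
    using insert by auto
  have zy: "z \<noteq> m y" using insert by auto
  have split: "1 / (z - m y) * (?c i / (z - m i)) =
      ?c i / (m y - m i) / (z - m y) + ?c i / (m i - m y) / (z - m i)" if "i \<in> I" for i
  proof -
    have "m y \<notin> m ` I" using insert by auto
    then have "m i \<noteq> m y" using that by (metis imageI)
    moreover have "z \<noteq> m i" using insert that by auto
    ultimately show ?thesis using zy by (simp add: divide_simps) (simp add: algebra_simps)
  qed
  have "(\<Prod>i\<in>insert y I. 1 + 1 / (z - m i)) =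
      (1 + 1 / (z - m y)) * (1 + (\<Sum>i\<in>I. ?c i / (z - m i)))"
    using insert IHz by simp
  also have "\<dots> = 1 + 1 / (z - m y) + (\<Sum>i\<in>I. ?c i / (z - m i))
      + (\<Sum>i\<in>I. 1 / (z - m y) * (?c i / (z - m i)))"
    unfolding sum_distrib_left[symmetric]
    by (simp only: distrib_left distrib_right mult_1 mult_1_right ac_simps)
  also have "(\<Sum>i\<in>I. 1 / (z - m y) * (?c i / (z - m i))) =
      (\<Sum>i\<in>I. ?c i / (m y - m i) / (z - m y)) + (\<Sum>i\<in>I. ?c i / (m i - m y) / (z - m i))"
    unfolding sum.distrib[symmetric] by (intro sum.cong refl split)
  also have "1 + 1 / (z - m y) + (\<Sum>i\<in>I. ?c i / (z - m i)) + \<dots> =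
      1 + (1 + (\<Sum>i\<in>I. ?c i / (m y - m i))) / (z - m y)
      + (\<Sum>i\<in>I. (1 + 1 / (m i - m y)) * ?c i / (z - m i))"
    by (simp add: algebra_simps add_divide_distrib sum.distrib sum_divide_distrib)
  also have "\<dots> = 1 + (\<Sum>i\<in>insert y I. jump_weight (insert y I) m i / (z - m i))"
    using insert by (simp add: jump_weight_insert_new IHy jump_weight_insert)
  finally show ?case .
qed simp

text \<open>The walk is a probability kernel after division by the number of walkers. By partial fractions, a
  new walker has weight one plus exactly the amount by which the weights of the others drop.\<close>

lemma sum_jump_weight:
  assumes "finite I" "inj_on m I"
  shows "(\<Sum>i\<in>I. jump_weight I m i) = card I"
  using assms
proof (induction I rule: finite_induct)
  case (insert y I)
  have pf: "(\<Prod>i\<in>I. 1 + 1 / (m y - m i)) = 1 + (\<Sum>i\<in>I. jump_weight I m i / (m y - m i))"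
    using insert by (intro jump_weight_partial_fractions) auto
  have "(\<Sum>i\<in>insert y I. jump_weight (insert y I) m i) =
     1 + (\<Sum>i\<in>I. jump_weight I m i / (m y - m i)) +
     (\<Sum>i\<in>I. jump_weight I m i + jump_weight I m i / (m i - m y))"
    using insert by (simp add: jump_weight_insert_new pf jump_weight_insert algebra_simps)
  also have "\<dots> = 1 + (\<Sum>i\<in>I. jump_weight I m i) +
     (\<Sum>i\<in>I. jump_weight I m i / (m y - m i) + jump_weight I m i / (m i - m y))"
    by (simp add: sum.distrib)
  also have "(\<Sum>i\<in>I. jump_weight I m i / (m y - m i) + jump_weight I m i / (m i - m y)) = 0"
  proof (intro sum.neutral ballI)
    fix i
    have "m i - m y = - (m y - m i)" by simp
    then show "jump_weight I m i / (m y - m i) + jump_weight I m i / (m i - m y) = 0"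
      by (metis add.right_inverse divide_minus_right)
  qed
  finally show ?case using insert by simp
qed simp

text \<open>The state space of the walk. Integrality makes gaps at least one, so that a jump of size one can
  close a gap but never reverse the order.\<close>

definition lattice_chamber :: "nat \<Rightarrow> (nat \<Rightarrow> real) \<Rightarrow> bool" where
  "lattice_chamber N m \<longleftrightarrow> (\<forall>i<N. m i \<in> \<int>) \<and> (\<forall>i j. i < j \<longrightarrow> j < N \<longrightarrow> m j < m i)"

lemma Ints_less_imp_add1_le:
  assumes "x \<in> \<int>" "y \<in> \<int>" "x < (y :: real)"
  shows "x + 1 \<le> y"
  using assms by (auto elim!: Ints_cases)

lemma lattice_chamber_gap:
  assumes "lattice_chamber N m" "i < j" "j < N"
  shows "m j + 1 \<le> m i"
  using assms by (auto simp: lattice_chamber_def intro!: Ints_less_imp_add1_le)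

lemma lattice_chamber_inj:
  assumes "lattice_chamber N m"
  shows "inj_on m {..<N}"
  using assms unfolding lattice_chamber_def inj_on_def
  by (metis lessThan_iff less_irrefl nat_neq_iff)

lemma jump_weight_nonneg:
  assumes m: "lattice_chamber N m" and I: "I \<subseteq> {..<N}" and i: "i < N"
  shows "0 \<le> jump_weight I m i"
  unfolding jump_weight_def
proof (rule prod_nonneg)
  fix j assume j: "j \<in> I - {i}"
  then consider "i < j" "j < N" | "j < i" using I by fastforce
  then show "0 \<le> 1 + 1 / (m i - m j)"
  proof cases
    case 1 then show ?thesis using lattice_chamber_gap[OF m, of i j] by simp
  next
    case 2
    then have "m i - m j \<le> -1" using lattice_chamber_gap[OF m, of j i] i by simp
    then show ?thesis by (simp add: divide_simps)
  qed
qed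

text \<open>Walkers of another block \<open>J\<close> enter a weight only through one product over \<open>J\<close>. This separates
  the dependence on the two blocks in the comparison below.\<close>

lemma jump_weight_split:
  assumes "finite I" "finite J" "I \<inter> J = {}" "i \<in> I"
  shows "jump_weight (I \<union> J) m i = jump_weight I m i * (\<Prod>j\<in>J. 1 + 1 / (m i - m j))"
proof -
  have "(I \<union> J) - {i} = (I - {i}) \<union> J" using assms by auto
  then show ?thesis
    unfolding jump_weight_def using assms by (subst prod.union_disjoint[symmetric]) auto
qed

text \<open>The logarithm of a factor, \<open>ln (a - b + 1) - ln (a - b)\<close>, is convex in \<open>b < a\<close>.\<close>

lemma prod_one_plus_mono:
  fixes a :: real
  assumes "\<And>i. i < N \<Longrightarrow> m i < a" "\<And>i. i < N \<Longrightarrow> n i < a"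
    and dec: "\<And>i j. i < j \<Longrightarrow> j < N \<Longrightarrow> n j \<le> n i"
    and dom: "dominates N m n"
  shows "(\<Prod>i<N. 1 + 1 / (a - n i)) \<le> (\<Prod>i<N. 1 + 1 / (a - m i))"
proof -
  define f where "f = (\<lambda>b. ln (a - b + 1) - ln (a - b))"
  define f' where "f' = (\<lambda>b. 1 / (a - b) - 1 / (a - b + 1))"
  have ex: "1 + 1 / (a - b) = exp (f b)" if "b < a" for b
    using that by (simp add: f_def exp_diff divide_simps)
  have "(\<Sum>i<N. f (n i)) \<le> (\<Sum>i<N. f (m i))"
  proof (rule karamata[of "{..<a}" f f'])
    fix t assume "t \<in> {..<a}"
    then show "(f has_real_derivative f' t) (at t)"
      unfolding f_def f'_def by (auto intro!: derivative_eq_intros)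
  next
    fix s t assume st: "s \<in> {..<a}" "t \<in> {..<a}" "s \<le> t"
    have eq: "f' b = 1 / ((a - b) * (a - b + 1))" if "b < a" for b
      using that by (simp add: f'_def divide_simps)
    have "(a - t) * (a - t + 1) \<le> (a - s) * (a - s + 1)"
      using st by (intro mult_mono) auto
    moreover have "0 < (a - t) * (a - t + 1)" using st by simp
    ultimately show "f' s \<le> f' t" using st
      by (simp add: eq frac_le)
  qed (use assms in auto)
  then have "exp (\<Sum>i<N. f (n i)) \<le> exp (\<Sum>i<N. f (m i))" by simp
  then show ?thesis using assms(1,2) by (simp add: exp_sum ex)
qed

text \<open>Here the logarithm of a factor, \<open>ln (a - b - 1) - ln (a - b)\<close>, is concave in \<open>a > b + 1\<close>, so the
  inequality goes the other way. On the boundary \<open>a = b + 1\<close> a factor vanishes and the logarithm is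
  unavailable; if this happens for \<open>m\<close>, the left-hand side is zero. If it does not, it cannot happen
  for \<open>n\<close>, whose smallest entry is the larger one.\<close>

lemma prod_one_minus_mono:
  fixes b :: real
  assumes m: "\<And>i. i < N \<Longrightarrow> b + 1 \<le> m i" and n: "\<And>i. i < N \<Longrightarrow> b + 1 \<le> n i"
    and dec: "\<And>i j. i < j \<Longrightarrow> j < N \<Longrightarrow> n j \<le> n i"
    and dom: "dominates N m n"
  shows "(\<Prod>i<N. 1 + 1 / (b - m i)) \<le> (\<Prod>i<N. 1 + 1 / (b - n i))"
proof (cases "\<exists>i<N. m i = b + 1")
  case True
  then obtain i where "i < N" "m i = b + 1" by blast
  then have "(\<Prod>i<N. 1 + 1 / (b - m i)) = 0" by (intro prod_zero bexI[of _ i]) auto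
  moreover have "0 \<le> (\<Prod>i<N. 1 + 1 / (b - n i))"
  proof (rule prod_nonneg)
    fix i assume "i \<in> {..<N}"
    then have "b - n i \<le> -1" using n[of i] by simp
    then show "0 \<le> 1 + 1 / (b - n i)" by (simp add: divide_simps)
  qed
  ultimately show ?thesis by (rule ord_eq_le_trans)
next
  case False
  then have m': "b + 1 < m i" if "i < N" for i using m[OF that] that by fastforce
  have last: "m (N - 1) \<le> n (N - 1)" if "N > 0"
  proof -
    have "sum n {..<N - 1} \<le> sum m {..<N - 1}" "sum n {..<N} = sum m {..<N}"
      using dom that by (auto simp: dominates_def)
    moreover have "{..<N} = insert (N - 1) {..<N - 1}" using that by auto
    ultimately show ?thesis by simp
  qed
  have n': "b + 1 < n i" if "i < N" for i
  proof -
    have "n (N - 1) \<le> n i" using dec[of i "N - 1"] that by (cases "i = N - 1") auto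
    then show ?thesis using last m'[of "N - 1"] that by simp
  qed
  define f where "f = (\<lambda>a. ln (a - b) - ln (a - b - 1))"
  define f' where "f' = (\<lambda>a. 1 / (a - b) - 1 / (a - b - 1))"
  have ex: "1 + 1 / (b - a) = exp (- f a)" if "b + 1 < a" for a
  proof -
    have "1 + 1 / (b - a) = (a - b - 1) / (a - b)"
      using that by (simp add: divide_simps) (simp add: algebra_simps)
    then show ?thesis using that by (simp add: f_def exp_diff exp_minus)
  qed
  have "(\<Sum>i<N. f (n i)) \<le> (\<Sum>i<N. f (m i))"
  proof (rule karamata[of "{b + 1<..}" f f'])
    fix t assume "t \<in> {b + 1<..}"
    then show "(f has_real_derivative f' t) (at t)"
      unfolding f_def f'_def by (auto intro!: derivative_eq_intros)
  next
    fix s t assume st: "s \<in> {b + 1<..}" "t \<in> {b + 1<..}" "s \<le> t"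
    have eq: "f' a = - (1 / ((a - b) * (a - b - 1)))" if "b + 1 < a" for a
      using that by (simp add: f'_def divide_simps)
    have "(s - b) * (s - b - 1) \<le> (t - b) * (t - b - 1)"
      using st by (intro mult_mono) auto
    moreover have "0 < (s - b) * (s - b - 1)" using st by simp
    ultimately show "f' s \<le> f' t" using st
      by (simp add: eq frac_le)
  qed (use m' n' dec dom in auto)
  then have "exp (\<Sum>i<N. - f (m i)) \<le> exp (\<Sum>i<N. - f (n i))" by (simp add: sum_negf)
  then show ?thesis using m' n' by (simp only: exp_sum finite_lessThan) (simp add: ex)
qed

lemma jump_weight_cong:
  assumes "i \<in> I" "\<And>j. j \<in> I \<Longrightarrow> m j = n j"
  shows "jump_weight I m i = jump_weight I n i"
  unfolding jump_weight_def using assms by (intro prod.cong) auto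

text \<open>The core of the proof. At a contact \<open>k\<close>, where the \<open>k\<close>-th partial sums agree, both blocks
  \<open>A = {..<k}\<close> and \<open>B = {k..<N}\<close> of \<open>m\<close> majorize those of \<open>n\<close>. The walker that jumps is then more
  likely to be among the first \<open>k\<close> for \<open>m\<close> than for \<open>n\<close>, which is what keeps the contact
  inequality alive.

  The two blocks are exchanged one after the other, with the tuple \<open>r\<close> in between. While \<open>B\<close> varies,
  the total weight of \<open>A\<close> is a sum of terms \<open>jump_weight A n i\<close>, which stay fixed, times products
  covered by \<open>prod_one_plus_mono\<close>. While \<open>A\<close> varies, the weights inside \<open>A\<close> vary too; but the
  weight of \<open>A\<close> is \<open>N\<close> minus the weight of \<open>B\<close>, where only the products of \<open>prod_one_minus_mono\<close>
  change.\<close>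

lemma weight_partial_sum_mono:
  assumes m: "lattice_chamber N m" and n: "lattice_chamber N n"
    and dom: "dominates N m n" and k: "k < N"
    and contact: "sum m {..<k} = sum n {..<k}"
  shows "(\<Sum>i<k. jump_weight {..<N} n i) \<le> (\<Sum>i<k. jump_weight {..<N} m i)"
proof -
  define A where "A = {..<k}"
  define B where "B = {k..<N}"
  have AB: "finite A" "finite B" "A \<inter> B = {}" "A \<union> B = {..<N}"
    unfolding A_def B_def using k by auto
  note decm = m[unfolded lattice_chamber_def, THEN conjunct2, rule_format]
  note decn = n[unfolded lattice_chamber_def, THEN conjunct2, rule_format]
  define r where "r = (\<lambda>i. if i < k then n i else m i)"
  have rA: "r i = n i" if "i \<in> A" for i using that by (simp add: r_def A_def)
  have rB: "r i = m i" if "i \<in> B" for i using that by (simp add: r_def B_def)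
  have last: "m (k - 1) \<le> n (k - 1)" if "k > 0"
  proof -
    have "sum n {..<k - 1} \<le> sum m {..<k - 1}"
      using dom that k by (auto simp: dominates_def)
    moreover have "{..<k} = insert (k - 1) {..<k - 1}" using that by auto
    ultimately show ?thesis using contact by simp
  qed
  have cross: "r j < r i" if "i < k" "k \<le> j" "j < N" for i j
  proof -
    have "m j < m (k - 1)" using that decm by auto
    also have "\<dots> \<le> n (k - 1)" using that last by simp
    also have "\<dots> \<le> n i"
    proof -
      have "i = k - 1 \<or> i < k - 1" using that by linarith
      then show ?thesis using decn[of i "k - 1"] k by (auto simp: less_imp_diff_less)
    qed
    finally show ?thesis using that by (simp add: r_def)
  qed
  have r: "lattice_chamber N r"
    unfolding lattice_chamber_def
  proof (intro conjI allI impI)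
    fix i assume "i < N" then show "r i \<in> \<int>" using m n by (simp add: r_def lattice_chamber_def)
  next
    fix i j assume ij: "i < j" "j < N"
    then consider "j < k" | "k \<le> i" | "i < k" "k \<le> j" by linarith
    then show "r j < r i"
      by cases (use ij decm decn cross in \<open>auto simp: r_def\<close>)
  qed
  have card: "(\<Sum>i\<in>A. jump_weight {..<N} x i) = N - (\<Sum>i\<in>B. jump_weight {..<N} x i)"
    if "lattice_chamber N x" for x
  proof -
    have "(\<Sum>i\<in>A \<union> B. jump_weight {..<N} x i) = N"
      using sum_jump_weight[OF _ lattice_chamber_inj[OF that]] AB by simp
    then show ?thesis
      using sum.union_disjoint[OF AB(1-3), of "jump_weight {..<N} x"] by linarith
  qed
  have wA: "jump_weight {..<N} x i = jump_weight A x i * (\<Prod>j\<in>B. 1 + 1 / (x i - x j))"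
    if "i \<in> A" for x :: "nat \<Rightarrow> real" and i
    using jump_weight_split[of A B i x] AB that by simp
  have wB: "jump_weight {..<N} x i = jump_weight B x i * (\<Prod>j\<in>A. 1 + 1 / (x i - x j))"
    if "i \<in> B" for x :: "nat \<Rightarrow> real" and i
    using jump_weight_split[of B A i x] AB that by (simp add: Un_commute Int_commute)
  have step1: "(\<Sum>i\<in>A. jump_weight {..<N} n i) \<le> (\<Sum>i\<in>A. jump_weight {..<N} r i)"
  proof (rule sum_mono)
    fix i assume i: "i \<in> A"
    have B_shift: "(\<Prod>j\<in>B. g j) = (\<Prod>j<N - k. g (k + j))" for g :: "nat \<Rightarrow> real"
      unfolding B_def using k by (intro prod.reindex_bij_witness[of _ "\<lambda>j. k + j" "\<lambda>j. j - k"]) auto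
    have shift: "sum x {..<k + l} = sum x {..<k} + (\<Sum>j<l. x (k + j))" for x :: "nat \<Rightarrow> real" and l
      by (induction l) auto
    have tail: "dominates (N - k) (\<lambda>j. m (k + j)) (\<lambda>j. n (k + j))"
      unfolding dominates_def
    proof (intro conjI allI impI)
      fix l assume "l < N - k"
      then show "(\<Sum>j<l. n (k + j)) \<le> (\<Sum>j<l. m (k + j))"
        using dom[unfolded dominates_def, THEN conjunct1, rule_format, of "k + l"] contact k
        by (simp add: shift)
    next
      have "sum n {..<k + (N - k)} = sum m {..<k + (N - k)}"
        using dom k by (simp add: dominates_def)
      then show "(\<Sum>j<N - k. n (k + j)) = (\<Sum>j<N - k. m (k + j))"
        using contact by (simp only: shift)
    qed
    have "(\<Prod>j<N - k. 1 + 1 / (n i - n (k + j))) \<le> (\<Prod>j<N - k. 1 + 1 / (n i - m (k + j)))"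
    proof (rule prod_one_plus_mono[OF _ _ _ tail])
      fix j assume j: "j < N - k"
      show "m (k + j) < n i" using cross[of i "k + j"] i j by (simp add: r_def A_def)
      show "n (k + j) < n i" using decn i j by (simp add: A_def)
    next
      fix j l :: nat assume jl: "j < l" "l < N - k"
      then show "n (k + l) \<le> n (k + j)" by (intro less_imp_le decn) auto
    qed
    moreover have "jump_weight A r i = jump_weight A n i"
      using i rA by (intro jump_weight_cong) auto
    moreover have "(\<Prod>j\<in>B. 1 + 1 / (r i - r j)) = (\<Prod>j\<in>B. 1 + 1 / (n i - m j))"
      using i by (intro prod.cong) (auto simp: rA rB)
    moreover have "0 \<le> jump_weight A n i"
      using jump_weight_nonneg[OF n, of A i] i k by (auto simp: A_def)
    ultimately show "jump_weight {..<N} n i \<le> jump_weight {..<N} r i"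
      unfolding wA[OF i] by (simp add: B_shift mult_left_mono)
  qed
  have step2: "(\<Sum>i\<in>B. jump_weight {..<N} m i) \<le> (\<Sum>i\<in>B. jump_weight {..<N} r i)"
  proof (rule sum_mono)
    fix b assume b: "b \<in> B"
    have head: "dominates k m n"
      using dom contact k by (simp add: dominates_def)
    have "(\<Prod>j<k. 1 + 1 / (m b - m j)) \<le> (\<Prod>j<k. 1 + 1 / (m b - n j))"
    proof (rule prod_one_minus_mono[OF _ _ _ head])
      fix j assume j: "j < k"
      show "m b + 1 \<le> m j" using lattice_chamber_gap[OF m, of j b] j b by (simp add: B_def)
      show "m b + 1 \<le> n j"
        using lattice_chamber_gap[OF r, of j b] j b by (simp add: B_def r_def)
    next
      fix j l assume "j < l" "l < k"
      then show "n l \<le> n j" using k by (intro less_imp_le decn) auto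
    qed
    moreover have "jump_weight B r b = jump_weight B m b"
      using b rB by (intro jump_weight_cong) auto
    moreover have "(\<Prod>j\<in>A. 1 + 1 / (r b - r j)) = (\<Prod>j\<in>A. 1 + 1 / (m b - n j))"
      using b by (intro prod.cong) (auto simp: rA rB)
    moreover have "0 \<le> jump_weight B m b"
      using jump_weight_nonneg[OF m, of B b] b k by (auto simp: B_def subset_eq)
    ultimately show "jump_weight {..<N} m b \<le> jump_weight {..<N} r b"
      unfolding wB[OF b] by (simp add: A_def mult_left_mono)
  qed
  from step1 step2 show ?thesis
    using card[OF m] card[OF r] unfolding A_def by simp
qed

section \<open>The random walk respects majorization\<close>

lemma lattice_chamber_step:
  assumes m: "lattice_chamber N m" and i: "i < N"
  shows "0 < i \<and> m (i - 1) = m i + 1 \<or> lattice_chamber N (m(i := m i + 1))"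
proof (cases "0 < i \<and> m (i - 1) = m i + 1")
  case False
  note dec = m[unfolded lattice_chamber_def, THEN conjunct2, rule_format]
  have up: "m i + 1 < m j" if j: "j < i" for j
  proof -
    have "m i + 1 \<le> m (i - 1)" using lattice_chamber_gap[OF m, of "i - 1" i] j i by simp
    then have "m i + 1 < m (i - 1)" using False j by fastforce
    also have "m (i - 1) \<le> m j"
    proof -
      have "j = i - 1 \<or> j < i - 1" using j by linarith
      then show ?thesis using dec[of j "i - 1"] i by (auto simp: less_imp_diff_less)
    qed
    finally show ?thesis .
  qed
  have "lattice_chamber N (m(i := m i + 1))"
    unfolding lattice_chamber_def
  proof (intro conjI allI impI)
    fix j assume "j < N" then show "(m(i := m i + 1)) j \<in> \<int>"
      using m by (auto simp: lattice_chamber_def)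
  next
    fix j l assume jl: "j < l" "l < N"
    then show "(m(i := m i + 1)) l < (m(i := m i + 1)) j"
      using dec[of j l] up[of j] by auto
  qed
  then show ?thesis ..
qed blast

lemma jump_weight_eq_0_or_chamber:
  assumes m: "lattice_chamber N m" and i: "i < N"
  shows "jump_weight {..<N} m i = 0 \<or> lattice_chamber N (m(i := m i + 1))"
proof (cases "0 < i \<and> m (i - 1) = m i + 1")
  case True
  then have "jump_weight {..<N} m i = 0"
    unfolding jump_weight_def using i by (intro prod_zero bexI[of _ "i - 1"]) auto
  then show ?thesis ..
qed (use lattice_chamber_step[OF assms] in blast)

text \<open>Nonnegativity is included so that a forbidden jump, of weight zero, can be assigned the value zero
  without exceeding any value that the function takes.\<close>

definition isotone :: "nat \<Rightarrow> ((nat \<Rightarrow> real) \<Rightarrow> real) \<Rightarrow> bool" where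
  "isotone N f \<longleftrightarrow>
     (\<forall>m. lattice_chamber N m \<longrightarrow> 0 \<le> f m) \<and>
     (\<forall>m n. lattice_chamber N m \<longrightarrow> lattice_chamber N n \<longrightarrow> dominates N m n \<longrightarrow> f n \<le> f m)"

definition walk_step :: "nat \<Rightarrow> ((nat \<Rightarrow> real) \<Rightarrow> real) \<Rightarrow> (nat \<Rightarrow> real) \<Rightarrow> real" where
  "walk_step N f m = (\<Sum>i<N. jump_weight {..<N} m i * f (m(i := m i + 1)))"

lemma sum_upd_lessThan:
  fixes m :: "nat \<Rightarrow> real"
  shows "sum (m(i := m i + 1)) {..<k} = sum m {..<k} + (if i < k then 1 else 0)"
  by (induction k) auto

text \<open>One step from \<open>m\<close> and one from \<open>n\<close> must be compared. If \<open>i\<close> jumps in \<open>m\<close> and \<open>j\<close> in \<open>n\<close>, majorization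
  persists unless some contact \<open>k\<close> satisfies \<open>j < k \<le> i\<close>: away from contacts the partial sums differ
  by at least one, which absorbs the jump. By \<open>weight_partial_sum_mono\<close> the jumping index of \<open>m\<close> is
  stochastically to the left of that of \<open>n\<close> across every contact, so a coupling without bad pairs
  exists. Instead of a coupling, a function \<open>\<gamma>\<close> is interpolated between the two families of values: it
  lies above the values \<open>\<beta>\<close> reached from \<open>n\<close>, below those reached from \<open>m\<close>, and it decreases and
  changes only at contacts. Summation by parts then compares the two averages of \<open>\<gamma>\<close>.\<close>

lemma walk_step_isotone:
  assumes f: "isotone N f"
  shows "isotone N (walk_step N f)"
  unfolding isotone_def
proof (intro conjI allI impI)
  fix m assume m: "lattice_chamber N m"
  show "0 \<le> walk_step N f m"
    unfolding walk_step_def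
  proof (rule sum_nonneg)
    fix i assume i: "i \<in> {..<N}"
    then show "0 \<le> jump_weight {..<N} m i * f (m(i := m i + 1))"
      using jump_weight_eq_0_or_chamber[OF m, of i] jump_weight_nonneg[OF m, of "{..<N}" i] f
      by (auto simp: isotone_def)
  qed
next
  fix m n assume m: "lattice_chamber N m" and n: "lattice_chamber N n" and dom: "dominates N m n"
  show "walk_step N f n \<le> walk_step N f m"
  proof (cases "N = 0")
    case False
    let ?a = "jump_weight {..<N} m" and ?b = "jump_weight {..<N} n"
    \<comment> \<open>\<open>Z\<close> is the set of contacts; \<open>J i\<close> collects the jumps in \<open>n\<close> that are compatible with the jump \<open>i\<close> in \<open>m\<close>.\<close>
    define Z where "Z = {k. k < N \<and> sum m {..<k} = sum n {..<k}}"
    define \<beta> where "\<beta> = (\<lambda>j. if ?b j = 0 then 0 else f (n(j := n j + 1)))"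
    define J where "J = (\<lambda>i. {j. j < N \<and> (\<forall>k\<in>Z. k \<le> i \<longrightarrow> k \<le> j)})"
    define \<gamma> where "\<gamma> = (\<lambda>i. Max (\<beta> ` J i))"
    have fJ: "finite (J i)" for i by (simp add: J_def)
    have inJ: "i \<in> J i" if "i < N" for i using that by (auto simp: J_def)
    have gap: "sum n {..<k} + 1 \<le> sum m {..<k}" if "k < N" "k \<notin> Z" for k
    proof -
      have "sum n {..<k} < sum m {..<k}"
        using that dom by (auto simp: Z_def dominates_def order_less_le)
      moreover have "sum n {..<k} \<in> \<int>" "sum m {..<k} \<in> \<int>"
        using that m n by (auto simp: lattice_chamber_def intro!: Ints_sum)
      ultimately show ?thesis by (intro Ints_less_imp_add1_le)
    qed
    have below: "\<beta> j \<le> f (m(i := m i + 1))" if i: "i < N" "?a i \<noteq> 0" and j: "j \<in> J i" for i j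
    proof -
      have m': "lattice_chamber N (m(i := m i + 1))"
        using jump_weight_eq_0_or_chamber[OF m] i by blast
      show ?thesis
      proof (cases "?b j = 0")
        case True
        then show ?thesis using f m' by (simp add: \<beta>_def isotone_def)
      next
        case False
        have jN: "j < N" using j by (simp add: J_def)
        have n': "lattice_chamber N (n(j := n j + 1))"
          using jump_weight_eq_0_or_chamber[OF n jN] False by blast
        have "dominates N (m(i := m i + 1)) (n(j := n j + 1))"
          unfolding dominates_def sum_upd_lessThan
        proof (intro conjI allI impI)
          fix k assume k: "k < N"
          show "sum n {..<k} + (if j < k then 1 else 0) \<le> sum m {..<k} + (if i < k then 1 else 0)"
          proof (cases "k \<in> Z")
            case True
            then have "k \<le> i \<longrightarrow> k \<le> j" using j by (simp add: J_def)
            then show ?thesis using True by (auto simp: Z_def)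
          next
            case False
            then show ?thesis using gap[OF k] by auto
          qed
        qed (use dom i jN in \<open>simp add: dominates_def\<close>)
        then show ?thesis using f m' n' False by (simp add: \<beta>_def isotone_def)
      qed
    qed
    have anti: "\<gamma> k \<le> \<gamma> (k - 1)" if "0 < k" "k < N" for k
      unfolding \<gamma>_def using inJ[of k] that fJ
      by (intro Max_mono image_mono) (auto simp: J_def)
    have const: "\<gamma> k = \<gamma> (k - 1)" if "0 < k" "k \<notin> Z" for k
    proof -
      have "l \<le> k \<longleftrightarrow> l \<le> k - 1" if "l \<in> Z" for l
      proof -
        have "l \<noteq> k" using that \<open>k \<notin> Z\<close> by auto
        then show ?thesis using \<open>0 < k\<close> by linarith
      qed
      then have "J k = J (k - 1)" by (auto simp: J_def)
      then show ?thesis by (simp add: \<gamma>_def)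
    qed
    have "walk_step N f n = (\<Sum>i<N. ?b i * \<beta> i)"
      unfolding walk_step_def by (intro sum.cong) (auto simp: \<beta>_def)
    also have "\<dots> \<le> (\<Sum>i<N. ?b i * \<gamma> i)"
      using inJ fJ jump_weight_nonneg[OF n]
      by (intro sum_mono mult_left_mono) (auto simp: \<gamma>_def)
    also have "\<dots> \<le> (\<Sum>i<N. ?a i * \<gamma> i)"
    proof -
      have "0 \<le> (\<Sum>i<N. \<gamma> i * (?a i - ?b i))"
      proof (rule sum_mult_nonneg_by_partial_sums)
        fix k assume k: "0 < k" "k < N"
        show "0 \<le> (\<gamma> (k - 1) - \<gamma> k) * (\<Sum>i<k. ?a i - ?b i)"
        proof (cases "k \<in> Z")
          case True
          then have "sum m {..<k} = sum n {..<k}" by (simp add: Z_def)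
          from weight_partial_sum_mono[OF m n dom k(2) this] anti[OF k] show ?thesis
            by (simp add: sum_subtractf)
        qed (use const k in simp)
      next
        show "(\<Sum>i<N. ?a i - ?b i) = 0"
          using sum_jump_weight[OF _ lattice_chamber_inj[OF m]]
            sum_jump_weight[OF _ lattice_chamber_inj[OF n]] by (simp add: sum_subtractf)
      qed
      then show ?thesis by (simp add: algebra_simps sum_subtractf)
    qed
    also have "\<dots> \<le> walk_step N f m"
      unfolding walk_step_def
    proof (rule sum_mono)
      fix i assume i: "i \<in> {..<N}"
      show "?a i * \<gamma> i \<le> ?a i * f (m(i := m i + 1))"
      proof (cases "?a i = 0")
        case False
        then have "\<gamma> i \<le> f (m(i := m i + 1))"
          unfolding \<gamma>_def using i inJ[of i] fJ below by (subst Max_le_iff) auto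
        then show ?thesis using jump_weight_nonneg[OF m, of "{..<N}" i] i
          by (intro mult_left_mono) auto
      qed simp
    qed
    finally show ?thesis .
  qed (simp add: walk_step_def)
qed

section \<open>Vandermonde products and alternants\<close>

definition index_pairs :: "nat \<Rightarrow> (nat \<times> nat) set" where
  "index_pairs N = {(i, j). i < j \<and> j < N}"

definition vprod :: "nat \<Rightarrow> (nat \<Rightarrow> real) \<Rightarrow> real" where
  "vprod N t = (\<Prod>(i, j)\<in>index_pairs N. t j - t i)"

text \<open>The determinant of the matrix with entries \<open>u i powr m j\<close>, as a function of unbundled tuples.\<close>

definition alternant :: "nat \<Rightarrow> (nat \<Rightarrow> real) \<Rightarrow> (nat \<Rightarrow> real) \<Rightarrow> real" where
  "alternant N u m = (\<Sum>p | p permutes {..<N}. of_int (sign p) * (\<Prod>i<N. u i powr m (p i)))"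

text \<open>The permanent of the same matrix: a symmetric function to which the walk is applied, and whose
  product with the Vandermonde product alternates.\<close>

definition perm_sum :: "nat \<Rightarrow> (nat \<Rightarrow> real) \<Rightarrow> (nat \<Rightarrow> real) \<Rightarrow> real" where
  "perm_sum N u m = (\<Sum>p | p permutes {..<N}. \<Prod>i<N. u i powr m (p i))"

lemma finite_index_pairs: "finite (index_pairs N)"
  by (rule finite_subset[of _ "{..<N} \<times> {..<N}"]) (auto simp: index_pairs_def)

lemma vprod_eq_0_iff: "vprod N t = 0 \<longleftrightarrow> \<not> inj_on t {..<N}"
proof
  assume "vprod N t = 0"
  then obtain i j where "(i, j) \<in> index_pairs N" "t j - t i = 0"
    unfolding vprod_def prod_zero_iff[OF finite_index_pairs] by auto
  then have "i < N" "j < N" "i \<noteq> j" "t i = t j" by (auto simp: index_pairs_def)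
  then show "\<not> inj_on t {..<N}" by (metis inj_onD lessThan_iff)
next
  have zero: "vprod N t = 0" if "i < j" "j < N" "t i = t j" for i j
    unfolding vprod_def using that
    by (intro prod_zero finite_index_pairs bexI[of _ "(i, j)"]) (auto simp: index_pairs_def)
  assume "\<not> inj_on t {..<N}"
  then obtain i j where "i < N" "j < N" "i \<noteq> j" "t i = t j" by (auto simp: inj_on_def)
  then show "vprod N t = 0" using zero[of i j] zero[of j i] by (cases "i < j") auto
qed

text \<open>A permutation of the variables permutes the factors up to sign; the sign is the parity of the number
  of inversions, in a form that does not depend on \<open>t\<close>.\<close>

lemma vprod_compose_permutation:
  assumes p: "p permutes {..<N}"
  shows "vprod N (t \<circ> p) = vprod N t * (\<Prod>(i, j)\<in>index_pairs N. if p i < p j then 1 else - 1)"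
proof -
  define srt where "srt = (\<lambda>(i, j). (min (p i) (p j), max (p i) (p j)))"
  have inj: "p i = p j \<longleftrightarrow> i = j" for i j using permutes_inj[OF p] by (auto simp: inj_def)
  have pN: "p i < N" if "i < N" for i using permutes_in_image[OF p, of i] that by simp
  have "inj_on srt (index_pairs N)"
  proof (rule inj_onI)
    fix x y assume xy: "x \<in> index_pairs N" "y \<in> index_pairs N" "srt x = srt y"
    obtain i j k l where e: "x = (i, j)" "y = (k, l)" by (metis surj_pair)
    have "p i = p k \<and> p j = p l \<or> p i = p l \<and> p j = p k"
      using xy(3) unfolding e srt_def by (auto simp: min_def max_def split: if_splits)
    then show "x = y" using xy(1,2) unfolding e index_pairs_def by (auto simp: inj)
  qed
  moreover have "srt ` index_pairs N \<subseteq> index_pairs N"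
  proof clarify
    fix i j k l assume h: "(i, j) = srt (k, l)" "(k, l) \<in> index_pairs N"
    then have "k < l" "l < N" by (auto simp: index_pairs_def)
    moreover from this have "p k \<noteq> p l" by (simp add: inj)
    ultimately show "(i, j) \<in> index_pairs N"
      using h(1) pN[of k] pN[of l] by (auto simp: index_pairs_def srt_def min_def max_def)
  qed
  ultimately have bij: "bij_betw srt (index_pairs N) (index_pairs N)"
    using endo_inj_surj[OF finite_index_pairs] by (auto simp: bij_betw_def)
  have "vprod N (t \<circ> p) = (\<Prod>x\<in>index_pairs N. (case srt x of (i, j) \<Rightarrow> t j - t i) *
      (case x of (i, j) \<Rightarrow> if p i < p j then 1 else - 1))"
    unfolding vprod_def
  proof (rule prod.cong[OF refl])
    fix x assume "x \<in> index_pairs N"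
    obtain i j where "x = (i, j)" by force
    then show "(case x of (i, j) \<Rightarrow> (t \<circ> p) j - (t \<circ> p) i) =
      (case srt x of (i, j) \<Rightarrow> t j - t i) * (case x of (i, j) \<Rightarrow> if p i < p j then 1 else - 1)"
      by (simp add: srt_def min_def max_def)
  qed
  also have "\<dots> = vprod N t * (\<Prod>(i, j)\<in>index_pairs N. if p i < p j then 1 else - 1)"
    unfolding prod.distrib prod.reindex_bij_betw[OF bij, of "\<lambda>x. case x of (i, j) \<Rightarrow> t j - t i"]
    by (simp add: vprod_def)
  finally show ?thesis .
qed

text \<open>The inversions of the transposition are the pair \<open>(a, b)\<close> and, for every \<open>c\<close> strictly between, the
  two pairs \<open>(a, c)\<close> and \<open>(c, b)\<close>: an odd number.\<close>

lemma vprod_transpose: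
  assumes "a < b" "b < N"
  shows "vprod N (t \<circ> transpose a b) = - vprod N t"
proof -
  let ?p = "transpose a b"
  define K where "K = insert (a, b) (Pair a ` {a<..<b} \<union> (\<lambda>c. (c, b)) ` {a<..<b})"
  have K: "K \<subseteq> index_pairs N" using assms by (auto simp: K_def index_pairs_def)
  have "card (Pair a ` {a<..<b} \<union> (\<lambda>c. (c, b)) ` {a<..<b}) = 2 * card {a<..<b}"
    by (subst card_Un_disjoint) (auto simp: card_image inj_on_def)
  then have odd: "odd (card K)"
    unfolding K_def by (subst card_insert_disjoint) auto
  have val: "?p i < ?p j \<longleftrightarrow> (i, j) \<notin> K" if "(i, j) \<in> index_pairs N" for i j
    using that assms by (auto simp: K_def index_pairs_def transpose_def)
  have "(\<Prod>(i, j)\<in>index_pairs N. if ?p i < ?p j then 1 else - 1 :: real) =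
      (\<Prod>x\<in>index_pairs N. if x \<in> K then - 1 else 1)"
    by (intro prod.cong refl) (auto simp: val)
  also have "\<dots> = (\<Prod>x\<in>K. - 1)"
    using K by (intro prod.mono_neutral_cong_right) (auto simp: finite_index_pairs)
  also have "\<dots> = - 1" using odd by simp
  finally show ?thesis
    using vprod_compose_permutation[of ?p N t] assms permutes_swap_id[of a "{..<N}" b] by simp
qed

lemma vprod_transpose':
  assumes "a \<noteq> b" "a < N" "b < N"
  shows "vprod N (t \<circ> transpose a b) = - vprod N t"
  using assms vprod_transpose[of a b N t] vprod_transpose[of b a N t]
  by (metis nat_neq_iff transpose_commute)

lemma vprod_permutation:
  assumes p: "p permutes {..<N}"
  shows "vprod N (t \<circ> p) = of_int (sign p) * vprod N t"
  using p finite_lessThan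
proof (induction p arbitrary: t rule: permutes_induct)
  case (swap a b p)
  have "vprod N (t \<circ> (transpose a b \<circ> p)) = vprod N ((t \<circ> transpose a b) \<circ> p)"
    by (simp add: comp_assoc)
  also have "\<dots> = - (of_int (sign p) * vprod N t)"
    unfolding swap.IH using vprod_transpose'[of a b N t] swap.hyps by (simp del: comp_apply)
  also have "\<dots> = of_int (sign (transpose a b \<circ> p)) * vprod N t"
    using swap by (subst sign_compose)
      (auto simp: permutation_swap_id sign_swap_id intro: permutes_imp_permutation[of "{..<N}"])
  finally show ?case .
qed simp

lemma vprod_step:
  assumes inj: "inj_on m {..<N}" and i: "i < N"
  shows "vprod N (m(i := m i + 1)) = jump_weight {..<N} m i * vprod N m"
proof -
  define r where "r = (\<lambda>(a, b). if a = i then 1 + 1 / (m i - m b) else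
      if b = i then 1 + 1 / (m i - m a) else 1)"
  have "vprod N (m(i := m i + 1)) = (\<Prod>x\<in>index_pairs N. r x * (case x of (a, b) \<Rightarrow> m b - m a))"
    unfolding vprod_def
  proof (rule prod.cong[OF refl])
    fix x assume x: "x \<in> index_pairs N"
    obtain a b where e: "x = (a, b)" by force
    have ab: "a < b" "b < N" using x e by (auto simp: index_pairs_def)
    then have neq: "m a \<noteq> m b" using inj_onD[OF inj, of a b] by auto
    consider "a = i" "b \<noteq> i" | "a \<noteq> i" "b = i" | "a \<noteq> i" "b \<noteq> i" using ab by auto
    then show "(case x of (a, b) \<Rightarrow> (m(i := m i + 1)) b - (m(i := m i + 1)) a) =
        r x * (case x of (a, b) \<Rightarrow> m b - m a)"
    proof cases
      case 1
      then have "r x = (m b - (m i + 1)) / (m b - m i)"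
        using neq unfolding e r_def by (simp add: divide_simps) (simp add: algebra_simps)
      then show ?thesis using 1 neq unfolding e by simp
    next
      case 2
      then have "r x = (m i + 1 - m a) / (m i - m a)"
        using neq unfolding e r_def by (simp add: divide_simps)
      then show ?thesis using 2 neq unfolding e by simp
    next
      case 3
      then show ?thesis unfolding e r_def by simp
    qed
  qed
  also have "\<dots> = (\<Prod>x\<in>index_pairs N. r x) * vprod N m"
    by (simp add: prod.distrib vprod_def)
  also have "(\<Prod>x\<in>index_pairs N. r x) =
      (\<Prod>x\<in>(\<lambda>j. if j < i then (j, i) else (i, j)) ` ({..<N} - {i}). r x)"
  proof (rule prod.mono_neutral_right[OF finite_index_pairs])
    show "(\<lambda>j. if j < i then (j, i) else (i, j)) ` ({..<N} - {i}) \<subseteq> index_pairs N"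
      using i by (auto simp: index_pairs_def)
    show "\<forall>x\<in>index_pairs N - (\<lambda>j. if j < i then (j, i) else (i, j)) ` ({..<N} - {i}). r x = 1"
    proof
      fix x assume x: "x \<in> index_pairs N - (\<lambda>j. if j < i then (j, i) else (i, j)) ` ({..<N} - {i})"
      obtain a b where e: "x = (a, b)" by force
      have ab: "a < b" "b < N" using x e by (auto simp: index_pairs_def)
      have "a \<noteq> i"
      proof
        assume "a = i"
        then have "x = (if b < i then (b, i) else (i, b))" "b \<in> {..<N} - {i}" using ab e by auto
        then show False using x by blast
      qed
      moreover have "b \<noteq> i"
      proof
        assume "b = i"
        then have "x = (if a < i then (a, i) else (i, a))" "a \<in> {..<N} - {i}" using ab e by auto
        then show False using x by blast
      qed
      ultimately show "r x = 1" by (simp add: e r_def)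
    qed
  qed
  also have "\<dots> = (\<Prod>j\<in>{..<N} - {i}. r (if j < i then (j, i) else (i, j)))"
    by (subst prod.reindex) (auto simp: inj_on_def split: if_splits)
  also have "\<dots> = jump_weight {..<N} m i"
    unfolding jump_weight_def by (intro prod.cong) (auto simp: r_def)
  finally show ?thesis .
qed

lemma prod_powr_permutation:
  assumes p: "p permutes {..<N}"
  shows "(\<Prod>i<N. u i powr m (p i)) = (\<Prod>i<N. (u \<circ> inv_into UNIV p) i powr m i)"
  using prod.permute[OF p, of "\<lambda>i. (u \<circ> inv_into UNIV p) i powr m i"] permutes_inverses[OF p]
  by (simp add: o_def)

lemma perm_sum_symmetric:
  assumes q: "q permutes {..<N}"
  shows "perm_sum N u (m \<circ> q) = perm_sum N u m"
  unfolding perm_sum_def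
  by (subst (2) setum_permutations_compose_left[OF q]) simp

text \<open>In logarithmic coordinates \<open>x = ln u\<close> this is a sum of exponentials of linear forms, hence convex,
  and symmetric. Convexity gives a tangent bound with slopes \<open>g i\<close>, and symmetry makes the slopes
  decrease: pairing \<open>p\<close> with its composition with an adjacent transposition writes
  \<open>2 * (g (k - 1) - g k)\<close> as a sum of products of two factors of equal sign.\<close>

lemma perm_sum_isotone:
  assumes u: "\<And>i. i < N \<Longrightarrow> 0 < u i"
  shows "isotone N (perm_sum N u)"
  unfolding isotone_def
proof (intro conjI allI impI)
  fix m show "0 \<le> perm_sum N u m"
    unfolding perm_sum_def by (intro sum_nonneg prod_nonneg) auto
next
  fix m n assume m: "lattice_chamber N m" and n: "lattice_chamber N n" and dom: "dominates N m n"
  let ?P = "{p. p permutes {..<N}}"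
  define x where "x = (\<lambda>i. ln (u i))"
  define E where "E = (\<lambda>m p. \<Sum>i<N. x (p i) * m i)"
  have h: "perm_sum N u m = (\<Sum>p\<in>?P. exp (E m p))" for m
  proof -
    have "perm_sum N u m = (\<Sum>p\<in>?P. \<Prod>i<N. (u \<circ> inv_into UNIV p) i powr m i)"
      unfolding perm_sum_def by (intro sum.cong refl) (simp add: prod_powr_permutation)
    also have "\<dots> = (\<Sum>p\<in>?P. \<Prod>i<N. (u \<circ> p) i powr m i)"
      by (subst sum_permutations_inverse, intro sum.cong refl)
        (simp add: inv_inv_eq permutes_bij)
    also have "\<dots> = (\<Sum>p\<in>?P. exp (E m p))"
    proof (intro sum.cong refl)
      fix p assume p: "p \<in> ?P"
      have "(u \<circ> p) i powr m i = exp (x (p i) * m i)" if "i < N" for i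
      proof -
        have "p i < N" using p that permutes_in_image[of p "{..<N}" i] by simp
        then have "0 < u (p i)" by (rule u)
        then show ?thesis by (simp add: powr_def x_def mult.commute)
      qed
      then show "(\<Prod>i<N. (u \<circ> p) i powr m i) = exp (E m p)"
        unfolding E_def by (simp add: exp_sum)
    qed
    finally show ?thesis .
  qed
  define g where "g = (\<lambda>i. \<Sum>p\<in>?P. exp (E n p) * x (p i))"
  have g_mono: "g k \<le> g (k - 1)" if k: "0 < k" "k < N" for k
  proof -
    let ?t = "transpose (k - 1) k"
    have t: "?t permutes {..<N}" using k by (intro permutes_swap_id) auto
    have "g k = (\<Sum>p\<in>?P. exp (E n (p \<circ> ?t)) * x (p (k - 1)))"
      unfolding g_def by (subst sum_permutations_compose_right[OF t]) simp
    moreover have "g (k - 1) = (\<Sum>p\<in>?P. exp (E n (p \<circ> ?t)) * x (p k))"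
      unfolding g_def by (subst sum_permutations_compose_right[OF t]) simp
    ultimately have "2 * (g (k - 1) - g k) = (g (k - 1) - g k) +
        ((\<Sum>p\<in>?P. exp (E n (p \<circ> ?t)) * x (p k)) -
         (\<Sum>p\<in>?P. exp (E n (p \<circ> ?t)) * x (p (k - 1))))"
      by simp
    also have "\<dots> = (\<Sum>p\<in>?P. (exp (E n p) - exp (E n (p \<circ> ?t))) * (x (p (k - 1)) - x (p k)))"
      unfolding g_def sum_subtractf[symmetric] sum.distrib[symmetric]
      by (intro sum.cong refl) (simp only: algebra_simps)
    also have "\<dots> \<ge> 0"
    proof (rule sum_nonneg)
      fix p assume "p \<in> ?P"
      have "E n (p \<circ> ?t) = (\<Sum>i<N. x (p i) * n (?t i))"
        unfolding E_def by (subst sum.permute[OF t]) (simp add: o_def)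
      then have "E n p - E n (p \<circ> ?t) = (\<Sum>i<N. x (p i) * (n i - n (?t i)))"
        unfolding E_def by (simp add: sum_subtractf algebra_simps)
      also have "\<dots> = (\<Sum>i\<in>{k - 1, k}. x (p i) * (n i - n (?t i)))"
        using k by (intro sum.mono_neutral_right) (auto simp: transpose_def)
      also have "\<dots> = (x (p (k - 1)) - x (p k)) * (n (k - 1) - n k)"
        using k by (simp add: algebra_simps)
      finally have diff: "E n p - E n (p \<circ> ?t) = (x (p (k - 1)) - x (p k)) * (n (k - 1) - n k)" .
      have "0 < n (k - 1) - n k" using n k by (simp add: lattice_chamber_def)
      then have "x (p k) \<le> x (p (k - 1)) \<Longrightarrow> E n (p \<circ> ?t) \<le> E n p"
        "x (p (k - 1)) \<le> x (p k) \<Longrightarrow> E n p \<le> E n (p \<circ> ?t)"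
        using diff mult_nonneg_nonneg[of "x (p (k - 1)) - x (p k)" "n (k - 1) - n k"]
          mult_nonpos_nonneg[of "x (p (k - 1)) - x (p k)" "n (k - 1) - n k"] by linarith+
      then show "0 \<le> (exp (E n p) - exp (E n (p \<circ> ?t))) * (x (p (k - 1)) - x (p k))"
        by (cases "x (p k) \<le> x (p (k - 1))") (auto intro: mult_nonneg_nonneg mult_nonpos_nonpos)
    qed
    finally show ?thesis by simp
  qed
  have "0 \<le> (\<Sum>i<N. g i * (m i - n i))"
  proof (rule sum_mult_nonneg_by_partial_sums)
    fix k assume k: "0 < k" "k < N"
    then show "0 \<le> (g (k - 1) - g k) * (\<Sum>i<k. m i - n i)"
      using g_mono[OF k] dom by (simp add: dominates_def sum_subtractf)
  qed (use dom in \<open>simp add: dominates_def sum_subtractf\<close>)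
  also have "\<dots> = (\<Sum>i<N. \<Sum>p\<in>?P. exp (E n p) * (x (p i) * (m i - n i)))"
    by (simp add: g_def sum_distrib_right mult.assoc)
  also have "\<dots> = (\<Sum>p\<in>?P. \<Sum>i<N. exp (E n p) * (x (p i) * (m i - n i)))"
    by (rule sum.swap)
  also have "\<dots> = (\<Sum>p\<in>?P. exp (E n p) * (E m p - E n p))"
  proof (intro sum.cong refl)
    fix p
    have "E m p - E n p = (\<Sum>i<N. x (p i) * (m i - n i))"
      by (simp add: E_def sum_subtractf right_diff_distrib)
    then show "(\<Sum>i<N. exp (E n p) * (x (p i) * (m i - n i))) = exp (E n p) * (E m p - E n p)"
      by (simp only: sum_distrib_left)
  qed
  also have "\<dots> \<le> (\<Sum>p\<in>?P. exp (E m p) - exp (E n p))"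
  proof (rule sum_mono)
    fix p
    have "exp (E n p) * (1 + (E m p - E n p)) \<le> exp (E n p) * exp (E m p - E n p)"
      by (intro mult_left_mono exp_ge_add_one_self) auto
    then show "exp (E n p) * (E m p - E n p) \<le> exp (E m p) - exp (E n p)"
      by (simp add: exp_diff algebra_simps)
  qed
  finally show "perm_sum N u n \<le> perm_sum N u m" by (simp add: h sum_subtractf)
qed

section \<open>The asymptotics of the iterated shift operator\<close>

text \<open>The sum of the unit shifts in all coordinates. It has constant coefficients, so its powers are easy
  to control; conjugation by the Vandermonde product turns it into the walk.\<close>

definition step_sum :: "nat \<Rightarrow> ((nat \<Rightarrow> real) \<Rightarrow> real) \<Rightarrow> (nat \<Rightarrow> real) \<Rightarrow> real" where
  "step_sum N g m = (\<Sum>i<N. g (m(i := m i + 1)))"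

lemma step_sum_pow_Suc:
  "(step_sum N ^^ Suc T) g m = (\<Sum>i<N. (step_sum N ^^ T) g (m(i := m i + 1)))"
  by (simp add: step_sum_def)

lemma walk_step_pow_Suc:
  "(walk_step N ^^ Suc T) f m =
    (\<Sum>i<N. jump_weight {..<N} m i * (walk_step N ^^ T) f (m(i := m i + 1)))"
  by (simp add: walk_step_def)

lemma step_sum_pow_alternating:
  assumes alt: "\<And>m a b. a \<noteq> b \<Longrightarrow> a < N \<Longrightarrow> b < N \<Longrightarrow> g (m \<circ> transpose a b) = - g m"
    and ab: "a \<noteq> b" "a < N" "b < N"
  shows "(step_sum N ^^ T) g (m \<circ> transpose a b) = - (step_sum N ^^ T) g m"
proof (induction T arbitrary: m)
  case 0
  show ?case by (simp only: funpow.simps id_apply alt[OF ab])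
next
  case (Suc T)
  let ?t = "transpose a b"
  have t: "?t permutes {..<N}" using ab by (intro permutes_swap_id) auto
  have upd: "(m \<circ> ?t)(i := (m \<circ> ?t) i + 1) = (m(?t i := m (?t i) + 1)) \<circ> ?t" for i
    by (rule ext) (auto simp: transpose_def)
  have "(step_sum N ^^ Suc T) g (m \<circ> ?t) =
      (\<Sum>i<N. - (step_sum N ^^ T) g (m(?t i := m (?t i) + 1)))"
    unfolding step_sum_pow_Suc upd Suc.IH ..
  also have "\<dots> = (\<Sum>i<N. - (step_sum N ^^ T) g (m(i := m i + 1)))"
    using sum.permute[OF t, of "\<lambda>i. - (step_sum N ^^ T) g (m(i := m i + 1))"]
    by (simp only: o_def)
  finally show ?case unfolding step_sum_pow_Suc by (simp only: sum_negf)
qed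

text \<open>A jump that leaves the chamber makes two entries equal. There the alternating function
  \<open>vprod N m * h m\<close> and all its images under \<open>step_sum\<close> vanish, in agreement with the zero weight of
  such a jump.\<close>

lemma step_sum_pow_walk_step:
  assumes sym: "\<And>m a b. a \<noteq> b \<Longrightarrow> a < N \<Longrightarrow> b < N \<Longrightarrow> h (m \<circ> transpose a b) = h m"
    and m: "lattice_chamber N m"
  shows "(step_sum N ^^ T) (\<lambda>m. vprod N m * h m) m = vprod N m * (walk_step N ^^ T) h m"
  using m
proof (induction T arbitrary: m)
  case (Suc T)
  let ?g = "\<lambda>m. vprod N m * h m"
  have "(step_sum N ^^ T) ?g (m(i := m i + 1)) =
      vprod N m * (jump_weight {..<N} m i * (walk_step N ^^ T) h (m(i := m i + 1)))"
    if i: "i < N" for i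
  proof -
    let ?m' = "m(i := m i + 1)"
    have v: "vprod N ?m' = jump_weight {..<N} m i * vprod N m"
      using vprod_step[OF lattice_chamber_inj[OF Suc.prems] i] .
    consider "0 < i" "m (i - 1) = m i + 1" | "lattice_chamber N ?m'"
      using lattice_chamber_step[OF Suc.prems i] by auto
    then show ?thesis
    proof cases
      case 1
      have sw: "?m' \<circ> transpose (i - 1) i = ?m'"
        using 1 by (intro ext) (auto simp: transpose_def)
      have "(step_sum N ^^ T) ?g (?m' \<circ> transpose (i - 1) i) = - (step_sum N ^^ T) ?g ?m'"
        using 1 i by (intro step_sum_pow_alternating) (auto simp: vprod_transpose' sym)
      then have "(step_sum N ^^ T) ?g ?m' = 0" unfolding sw by linarith
      moreover have "\<not> inj_on ?m' {..<N}"
      proof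
        assume "inj_on ?m' {..<N}"
        then have "i - 1 = i" by (rule inj_onD) (use 1 i in auto)
        then show False using 1 by simp
      qed
      then have "jump_weight {..<N} m i * vprod N m = 0"
        unfolding v[symmetric] vprod_eq_0_iff .
      ultimately show ?thesis by auto
    next
      case 2
      then show ?thesis unfolding Suc.IH[OF 2] v by (simp only: mult_ac)
    qed
  qed
  then show ?case
    unfolding step_sum_pow_Suc walk_step_pow_Suc sum_distrib_left by (intro sum.cong refl) simp
qed simp

text \<open>The commutator of \<open>step_sum\<close> with multiplication by the coordinate \<open>m j\<close> is the shift in
  coordinate \<open>j\<close>, and shifts commute with \<open>step_sum\<close>. For \<open>T = 0\<close> the truncated \<open>T - 1\<close> is harmless,
  since its factor is zero.\<close>

lemma step_sum_pow_mult_diff: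
  assumes "i < N" "j < N"
  shows "(step_sum N ^^ T) (\<lambda>m. (m j - m i) * g m) m = (m j - m i) * (step_sum N ^^ T) g m +
    T * ((step_sum N ^^ (T - 1)) g (m(j := m j + 1)) - (step_sum N ^^ (T - 1)) g (m(i := m i + 1)))"
proof (induction T arbitrary: m)
  case (Suc T)
  let ?A = "step_sum N"
  let ?b = "\<lambda>i (m :: nat \<Rightarrow> real). m(i := m i + 1)"
  have comm: "?b l (?b k m) = ?b k (?b l m)" for k l by (rule ext) auto
  have S: "(\<Sum>k<N. T * (?A ^^ (T - 1)) g (?b l (?b k m))) = T * (?A ^^ T) g (?b l m)" for l
  proof (cases T)
    case (Suc T')
    then show ?thesis
      unfolding sum_distrib_left[symmetric] comm[of l] Suc step_sum_pow_Suc by simp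
  qed simp
  have "(?A ^^ Suc T) (\<lambda>m. (m j - m i) * g m) m =
     (\<Sum>k<N. (?b k m j - ?b k m i) * (?A ^^ T) g (?b k m) +
       T * ((?A ^^ (T - 1)) g (?b j (?b k m)) - (?A ^^ (T - 1)) g (?b i (?b k m))))"
    unfolding step_sum_pow_Suc Suc.IH ..
  also have "\<dots> = (\<Sum>k<N. (?b k m j - ?b k m i) * (?A ^^ T) g (?b k m)) +
      ((\<Sum>k<N. T * (?A ^^ (T - 1)) g (?b j (?b k m))) -
       (\<Sum>k<N. T * (?A ^^ (T - 1)) g (?b i (?b k m))))"
    unfolding sum.distrib right_diff_distrib sum_subtractf ..
  also have "(\<Sum>k<N. (?b k m j - ?b k m i) * (?A ^^ T) g (?b k m)) =
     (\<Sum>k<N. (m j - m i) * (?A ^^ T) g (?b k m) +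
       ((if k = j then (?A ^^ T) g (?b k m) else 0) - (if k = i then (?A ^^ T) g (?b k m) else 0)))"
    by (intro sum.cong refl) (auto simp: algebra_simps)
  also have "\<dots> = (m j - m i) * (?A ^^ Suc T) g m + ((?A ^^ T) g (?b j m) - (?A ^^ T) g (?b i m))"
    using assms unfolding sum.distrib sum_subtractf step_sum_pow_Suc by (simp add: sum_distrib_left)
  also have "(m j - m i) * (?A ^^ Suc T) g m + ((?A ^^ T) g (?b j m) - (?A ^^ T) g (?b i m)) +
      ((\<Sum>k<N. T * (?A ^^ (T - 1)) g (?b j (?b k m))) -
       (\<Sum>k<N. T * (?A ^^ (T - 1)) g (?b i (?b k m)))) =
      (m j - m i) * (?A ^^ Suc T) g m +
      Suc T * ((?A ^^ (Suc T - 1)) g (?b j m) - (?A ^^ (Suc T - 1)) g (?b i m))"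
    unfolding S diff_Suc_1 of_nat_Suc by (simp only: algebra_simps)
  finally show ?case .
qed simp

lemma prod_powr_step:
  fixes m w :: "nat \<Rightarrow> real"
  assumes w: "\<And>i. i < N \<Longrightarrow> 0 < w i" and k: "k < N"
  shows "(\<Prod>i<N. w i powr (m(k := m k + 1)) i) = w k * (\<Prod>i<N. w i powr m i)"
proof -
  have "(\<Prod>i<N. w i powr (m(k := m k + 1)) i) =
      (\<Prod>i<N. (if i = k then w k else 1) * (w i powr m i))"
    using w by (intro prod.cong refl) (auto simp: powr_add abs_of_pos)
  then show ?thesis using k by (simp add: prod.distrib)
qed

lemma step_sum_pow_powr:
  assumes w: "\<And>i. i < N \<Longrightarrow> 0 < w i"
  shows "(step_sum N ^^ T) (\<lambda>m. \<Prod>i<N. w i powr m i) m = (\<Sum>i<N. w i) ^ T * (\<Prod>i<N. w i powr m i)"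
proof (induction T arbitrary: m)
  case (Suc T)
  show ?case
    unfolding step_sum_pow_Suc Suc.IH using prod_powr_step[of N w _ m] w
    by (simp add: sum_distrib_left sum_distrib_right algebra_simps)
qed simp

text \<open>By \<open>step_sum_pow_mult_diff\<close> an additional factor \<open>m j - m i\<close> contributes \<open>T\<close> times a difference of
  shifts, and a shift in coordinate \<open>j\<close> multiplies the exponential by \<open>w j\<close>; dividing by one more
  power of \<open>T\<close> and \<open>W\<close> leaves the factor \<open>(w j - w i) / W\<close>. In terms of the walk, \<open>T\<close> steps with jump
  probabilities \<open>w j / W\<close> displace \<open>m j\<close> by about \<open>T * w j / W\<close>. Arbitrary sets \<open>R\<close> of factors are
  allowed for the sake of the induction.\<close>

lemma step_sum_pow_asymptotics:
  assumes w: "\<And>i. i < N \<Longrightarrow> 0 < w i" and N: "0 < N"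
    and R: "finite R" "R \<subseteq> {..<N} \<times> {..<N}"
  defines "W \<equiv> (\<Sum>i<N. w i)"
  shows "(\<lambda>T. (step_sum N ^^ T) (\<lambda>m. (\<Prod>(i, j)\<in>R. m j - m i) * (\<Prod>i<N. w i powr m i)) m /
      (W ^ T * real T ^ card R)) \<longlonglongrightarrow>
    (\<Prod>(i, j)\<in>R. w j - w i) / W ^ card R * (\<Prod>i<N. w i powr m i)"
  using R
proof (induction R arbitrary: m rule: finite_induct)
  case empty
  have "0 < W" unfolding W_def using w N by (intro sum_pos) auto
  then show ?case by (simp add: step_sum_pow_powr[OF w] W_def[symmetric])
next
  case (insert x R)
  have W: "0 < W" unfolding W_def using w N by (intro sum_pos) auto
  obtain i j where x: "x = (i, j)" by force
  have ij: "i < N" "j < N" using insert.prems x by auto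
  let ?A = "step_sum N" and ?d = "card R"
  let ?e = "\<lambda>m. \<Prod>i<N. w i powr m i"
  let ?L = "(\<Prod>(i, j)\<in>R. w j - w i) / W ^ ?d"
  define g where "g = (\<lambda>m. (\<Prod>(i, j)\<in>R. m j - m i) * ?e m)"
  have IH: "(\<lambda>T. (?A ^^ T) g m / (W ^ T * real T ^ ?d)) \<longlonglongrightarrow> ?L * ?e m" for m
    unfolding g_def using insert by auto
  have e_up: "?e (m(k := m k + 1)) = w k * ?e m" if "k < N" for k
    using prod_powr_step[OF w that] .
  have up: "(\<lambda>T. (?A ^^ T) g (m(k := m k + 1)) / (W ^ T * real T ^ ?d) * (real T / real (Suc T)) ^ ?d / W)
      \<longlonglongrightarrow> ?L * (w k * ?e m) * 1 ^ ?d / W" if "k < N" for k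
    unfolding e_up[OF that, symmetric]
    by (intro tendsto_intros IH LIMSEQ_n_over_Suc_n) (use W in auto)
  have first: "(\<lambda>T. (m j - m i) * ((?A ^^ Suc T) g m / (W ^ Suc T * real (Suc T) ^ ?d)) * (1 / real (Suc T)))
      \<longlonglongrightarrow> (m j - m i) * (?L * ?e m) * 0"
    by (intro tendsto_intros LIMSEQ_Suc[OF IH] LIMSEQ_Suc[OF lim_1_over_n])
  have "(\<lambda>T. (?A ^^ Suc T) (\<lambda>m. (m j - m i) * g m) m / (W ^ Suc T * real (Suc T) ^ Suc ?d))
     \<longlonglongrightarrow> (m j - m i) * (?L * ?e m) * 0 +
       (?L * (w j * ?e m) * 1 ^ ?d / W - ?L * (w i * ?e m) * 1 ^ ?d / W)"
  proof (rule Lim_transform_eventually[OF tendsto_add[OF first tendsto_diff[OF up[OF ij(2)] up[OF ij(1)]]]])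
    show "\<forall>\<^sub>F T in sequentially.
      (m j - m i) * ((?A ^^ Suc T) g m / (W ^ Suc T * real (Suc T) ^ ?d)) * (1 / real (Suc T)) +
      ((?A ^^ T) g (m(j := m j + 1)) / (W ^ T * real T ^ ?d) * (real T / real (Suc T)) ^ ?d / W -
       (?A ^^ T) g (m(i := m i + 1)) / (W ^ T * real T ^ ?d) * (real T / real (Suc T)) ^ ?d / W) =
      (?A ^^ Suc T) (\<lambda>m. (m j - m i) * g m) m / (W ^ Suc T * real (Suc T) ^ Suc ?d)"
      using eventually_gt_at_top[of 0]
    proof eventually_elim
      case (elim T)
      have r: "y / (W ^ T * real T ^ ?d) * (real T / real (Suc T)) ^ ?d / W =
          real (Suc T) * y / (W ^ Suc T * real (Suc T) ^ Suc ?d)" for y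
        using elim W by (simp add: power_divide field_simps del: of_nat_Suc)
      have "(m j - m i) * (z / (W ^ Suc T * real (Suc T) ^ ?d)) * (1 / real (Suc T)) =
          (m j - m i) * z / (W ^ Suc T * real (Suc T) ^ Suc ?d)" for z
        by simp
      then show ?case
        unfolding r step_sum_pow_mult_diff[OF ij]
        by (simp only: diff_Suc_1 add_divide_distrib diff_divide_distrib right_diff_distrib)
    qed
  qed
  then have "(\<lambda>T. (?A ^^ T) (\<lambda>m. (m j - m i) * g m) m / (W ^ T * real T ^ Suc ?d))
     \<longlonglongrightarrow> (m j - m i) * (?L * ?e m) * 0 +
       (?L * (w j * ?e m) * 1 ^ ?d / W - ?L * (w i * ?e m) * 1 ^ ?d / W)"
    by (rule LIMSEQ_imp_Suc)
  moreover have "(m j - m i) * (?L * ?e m) * 0 +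
       (?L * (w j * ?e m) * 1 ^ ?d / W - ?L * (w i * ?e m) * 1 ^ ?d / W) =
      (\<Prod>(i, j)\<in>insert x R. w j - w i) / W ^ card (insert x R) * ?e m"
    using insert.hyps W by (simp add: x field_simps)
  moreover have "(\<lambda>m. (\<Prod>(i, j)\<in>insert x R. m j - m i) * ?e m) = (\<lambda>m. (m j - m i) * g m)"
    using insert.hyps by (simp add: x g_def mult.assoc)
  ultimately show ?case using insert.hyps by simp
qed

lemma step_sum_pow_sum:
  assumes "finite P"
  shows "(step_sum N ^^ T) (\<lambda>m. \<Sum>p\<in>P. g p m) m = (\<Sum>p\<in>P. (step_sum N ^^ T) (g p) m)"
proof (induction T arbitrary: m)
  case (Suc T)
  show ?case unfolding step_sum_pow_Suc Suc.IH by (rule sum.swap)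
qed simp

text \<open>Each term of the permanent is an exponential with permuted bases. Its limit carries the Vandermonde
  product of the permuted bases, whose sign turns the permanent into the determinant.\<close>

lemma step_sum_pow_vprod_perm_sum:
  assumes u: "\<And>i. i < N \<Longrightarrow> 0 < u i" and N: "0 < N"
  defines "W \<equiv> (\<Sum>i<N. u i)" and "d \<equiv> card (index_pairs N)"
  shows "(\<lambda>T. (step_sum N ^^ T) (\<lambda>m. vprod N m * perm_sum N u m) m / (W ^ T * real T ^ d))
     \<longlonglongrightarrow> vprod N u * alternant N u m / W ^ d"
proof -
  let ?P = "{p. p permutes {..<N}}"
  let ?v = "\<lambda>p. u \<circ> inv_into UNIV p"
  let ?e = "\<lambda>w m. \<Prod>i<N. w i powr m i"
  have fin: "finite ?P" by (simp add: finite_permutations)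
  have inv: "inv_into UNIV p permutes {..<N}" if "p \<in> ?P" for p using that by (simp add: permutes_inv)
  have "(\<lambda>m. vprod N m * perm_sum N u m) = (\<lambda>m. \<Sum>p\<in>?P. vprod N m * ?e (?v p) m)"
    unfolding perm_sum_def sum_distrib_left
    by (intro ext sum.cong refl) (simp only: prod_powr_permutation mem_Collect_eq)
  then have eq: "(step_sum N ^^ T) (\<lambda>m. vprod N m * perm_sum N u m) m / (W ^ T * real T ^ d) =
     (\<Sum>p\<in>?P. (step_sum N ^^ T) (\<lambda>m. vprod N m * ?e (?v p) m) m / (W ^ T * real T ^ d))" for T
    by (simp only: step_sum_pow_sum[OF fin] sum_divide_distrib)
  have lim: "(\<lambda>T. (step_sum N ^^ T) (\<lambda>m. vprod N m * ?e (?v p) m) m / (W ^ T * real T ^ d))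
     \<longlonglongrightarrow> vprod N u / W ^ d * (of_int (sign p) * (\<Prod>i<N. u i powr m (p i)))" if p: "p \<in> ?P" for p
  proof -
    have "0 < ?v p i" if "i < N" for i
      using u permutes_in_image[OF inv[OF p], of i] that by simp
    moreover have "(\<Sum>i<N. ?v p i) = W"
      unfolding W_def using sum.permute[OF inv[OF p], of u] by simp
    moreover have "index_pairs N \<subseteq> {..<N} \<times> {..<N}" by (auto simp: index_pairs_def)
    ultimately have "(\<lambda>T. (step_sum N ^^ T) (\<lambda>m. vprod N m * ?e (?v p) m) m / (W ^ T * real T ^ d))
       \<longlonglongrightarrow> vprod N (?v p) / W ^ d * ?e (?v p) m"
      using step_sum_pow_asymptotics[of N "?v p" "index_pairs N" m] N
      by (simp only: finite_index_pairs vprod_def d_def)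
    moreover have "vprod N (?v p) = of_int (sign p) * vprod N u"
      using vprod_permutation[OF inv[OF p]] p permutes_imp_permutation[of "{..<N}" p]
      by (simp add: sign_inverse)
    moreover have "?e (?v p) m = (\<Prod>i<N. u i powr m (p i))"
      using p by (simp only: prod_powr_permutation mem_Collect_eq)
    ultimately show ?thesis by (simp only: mult_ac times_divide_eq_left times_divide_eq_right)
  qed
  have "(\<lambda>T. \<Sum>p\<in>?P. (step_sum N ^^ T) (\<lambda>m. vprod N m * ?e (?v p) m) m / (W ^ T * real T ^ d))
     \<longlonglongrightarrow> (\<Sum>p\<in>?P. vprod N u / W ^ d * (of_int (sign p) * (\<Prod>i<N. u i powr m (p i))))"
    by (intro tendsto_sum lim)
  then show ?thesis
    unfolding eq alternant_def sum_distrib_left sum_divide_distrib times_divide_eq_left .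
qed

text \<open>The ratio is, up to a positive constant, the limit of the \<open>T\<close>-step walk applied to \<open>perm_sum N u\<close>,
  normalized independently of the starting point. Isotonicity and nonnegativity pass to the limit.\<close>

lemma lattice_alternant_ratio_mono:
  assumes u: "\<And>i. i < N \<Longrightarrow> 0 < u i"
    and m: "lattice_chamber N m" and n: "lattice_chamber N n" and dom: "dominates N m n"
  shows "0 \<le> vprod N u * alternant N u n / vprod N n"
    and "vprod N u * alternant N u n / vprod N n \<le> vprod N u * alternant N u m / vprod N m"
proof -
  have "0 \<le> vprod N u * alternant N u n / vprod N n \<and>
    vprod N u * alternant N u n / vprod N n \<le> vprod N u * alternant N u m / vprod N m"
  proof (cases "N = 0")
    case True
    then show ?thesis by (simp add: vprod_def index_pairs_def alternant_def)
  next
    case False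
    define W where "W = (\<Sum>i<N. u i)"
    define d where "d = card (index_pairs N)"
    define f where "f = (\<lambda>T. (walk_step N ^^ T) (perm_sum N u))"
    have W: "0 < W" unfolding W_def using u False by (intro sum_pos) auto
    have iso: "isotone N (f T)" for T
      unfolding f_def by (induction T) (auto intro: perm_sum_isotone u walk_step_isotone)
    have lim: "(\<lambda>T. f T x / (W ^ T * real T ^ d)) \<longlonglongrightarrow> vprod N u * alternant N u x / vprod N x / W ^ d"
      if x: "lattice_chamber N x" for x
    proof -
      have nz: "vprod N x \<noteq> 0" using lattice_chamber_inj[OF x] by (simp add: vprod_eq_0_iff)
      have "perm_sum N u (m \<circ> transpose a b) = perm_sum N u m" if "a < N" "b < N" for m a b
        using that by (intro perm_sum_symmetric permutes_swap_id) auto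
      then have "(step_sum N ^^ T) (\<lambda>m. vprod N m * perm_sum N u m) x = vprod N x * f T x" for T
        unfolding f_def by (intro step_sum_pow_walk_step x) auto
      then have "(\<lambda>T. vprod N x * f T x / (W ^ T * real T ^ d)) \<longlonglongrightarrow>
          vprod N u * alternant N u x / W ^ d"
        using step_sum_pow_vprod_perm_sum[of N u x] u False unfolding W_def d_def by simp
      then have "(\<lambda>T. vprod N x * f T x / (W ^ T * real T ^ d) / vprod N x) \<longlonglongrightarrow>
          vprod N u * alternant N u x / W ^ d / vprod N x"
        by (rule tendsto_divide[OF _ tendsto_const nz])
      then show ?thesis using nz by (simp add: mult.commute)
    qed
    have nonneg: "0 \<le> f T n / (W ^ T * real T ^ d)" for T
      using iso[of T] n W by (simp add: isotone_def)
    have mono: "f T n / (W ^ T * real T ^ d) \<le> f T m / (W ^ T * real T ^ d)" for T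
      using iso[of T] m n dom W by (intro divide_right_mono) (auto simp: isotone_def)
    have cancel: "x \<le> y" if "x / W ^ d \<le> y / W ^ d" for x y
      using that W by (simp add: divide_le_cancel)
    have "0 / W ^ d \<le> vprod N u * alternant N u n / vprod N n / W ^ d"
      unfolding div_0 by (rule LIMSEQ_le_const[OF lim[OF n]]) (use nonneg in blast)
    moreover have "vprod N u * alternant N u n / vprod N n / W ^ d
        \<le> vprod N u * alternant N u m / vprod N m / W ^ d"
      by (rule LIMSEQ_le[OF lim[OF n] lim[OF m]]) (use mono in blast)
    ultimately show ?thesis by (blast intro: cancel)
  qed
  then show "0 \<le> vprod N u * alternant N u n / vprod N n"
    "vprod N u * alternant N u n / vprod N n \<le> vprod N u * alternant N u m / vprod N m" by auto
qed

section \<open>From lattice tuples to real tuples\<close>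

lemma alternant_eq_0:
  assumes "\<not> inj_on u {..<N}"
  shows "alternant N u m = 0"
proof -
  obtain a b where ab: "a < N" "b < N" "a \<noteq> b" "u a = u b"
    using assms by (auto simp: inj_on_def)
  let ?t = "transpose a b" and ?P = "{p. p permutes {..<N}}"
  have t: "?t permutes {..<N}" using ab by (intro permutes_swap_id) auto
  have "alternant N u m =
      (\<Sum>p\<in>?P. of_int (sign (p \<circ> ?t)) * (\<Prod>i<N. u i powr m ((p \<circ> ?t) i)))"
    unfolding alternant_def by (rule sum_permutations_compose_right[OF t])
  also have "\<dots> = (\<Sum>p\<in>?P. - (of_int (sign p) * (\<Prod>i<N. u i powr m (p i))))"
  proof (intro sum.cong refl)
    fix p assume p: "p \<in> ?P"
    have "sign (p \<circ> ?t) = - sign p"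
      using p ab permutes_imp_permutation[of "{..<N}" p]
      by (subst sign_compose) (auto simp: permutation_swap_id sign_swap_id)
    moreover have "(\<Prod>i<N. u i powr m ((p \<circ> ?t) i)) = (\<Prod>i<N. u i powr m (p i))"
    proof -
      have "u (?t i) = u i" for i using ab(4) by (auto simp: transpose_def)
      then show ?thesis
        using prod.permute[OF t, of "\<lambda>i. u i powr m (p i)"] by (simp add: o_def)
    qed
    ultimately show "of_int (sign (p \<circ> ?t)) * (\<Prod>i<N. u i powr m ((p \<circ> ?t) i)) =
       - (of_int (sign p) * (\<Prod>i<N. u i powr m (p i)))" by simp
  qed
  also have "\<dots> = - alternant N u m" by (simp add: alternant_def sum_negf)
  finally show ?thesis by simp
qed

lemma lattice_abs_ratio_mono:
  assumes "\<And>i. i < N \<Longrightarrow> 0 < u i"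
    and "lattice_chamber N m" "lattice_chamber N n" "dominates N m n"
  shows "\<bar>alternant N u n\<bar> / \<bar>vprod N n\<bar> \<le> \<bar>alternant N u m\<bar> / \<bar>vprod N m\<bar>"
proof (cases "inj_on u {..<N}")
  case True
  then have "0 < \<bar>vprod N u\<bar>" by (simp add: vprod_eq_0_iff)
  moreover have "\<bar>vprod N u * alternant N u n / vprod N n\<bar> \<le> \<bar>vprod N u * alternant N u m / vprod N m\<bar>"
  proof -
    have "\<bar>x\<bar> \<le> \<bar>y\<bar>" if "0 \<le> x" "x \<le> y" for x y :: real using that by simp
    from this[OF lattice_alternant_ratio_mono] assms show ?thesis by blast
  qed
  then have "\<bar>vprod N u\<bar> * (\<bar>alternant N u n\<bar> / \<bar>vprod N n\<bar>) \<le>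
      \<bar>vprod N u\<bar> * (\<bar>alternant N u m\<bar> / \<bar>vprod N m\<bar>)"
    by (simp add: abs_mult)
  ultimately show ?thesis by (rule mult_le_cancel_left_pos[THEN iffD1])
qed (simp add: alternant_eq_0)

text \<open>Rounding a real tuple, scaled by \<open>q\<close>, to integers. Rounding the partial sums instead of the entries
  preserves majorization, including the equality of the totals.\<close>

definition grid_tuple :: "real \<Rightarrow> (nat \<Rightarrow> real) \<Rightarrow> nat \<Rightarrow> real" where
  "grid_tuple q m i = of_int (\<lfloor>q * sum m {..<Suc i}\<rfloor> - \<lfloor>q * sum m {..<i}\<rfloor>)"

lemma sum_grid_tuple: "sum (grid_tuple q m) {..<k} = of_int \<lfloor>q * sum m {..<k}\<rfloor>"
  by (induction k) (simp_all add: grid_tuple_def)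

lemma dominates_grid_tuple:
  assumes "dominates N m n" "0 \<le> q"
  shows "dominates N (grid_tuple q m) (grid_tuple q n)"
  using assms unfolding dominates_def sum_grid_tuple
  by (auto intro!: floor_mono mult_left_mono)

lemma tendsto_grid_tuple:
  "(\<lambda>k. grid_tuple (real (Suc k)) m i / real (Suc k)) \<longlonglongrightarrow> m i"
proof (rule tendsto_sandwich[of "\<lambda>k. m i - 1 / real (Suc k)" _ _ "\<lambda>k. m i + 1 / real (Suc k)"])
  have bound: "\<bar>grid_tuple q m i - q * m i\<bar> \<le> 1" for q
    unfolding grid_tuple_def sum.lessThan_Suc distrib_left by linarith
  have "m i - 1 / real (Suc k) \<le> grid_tuple (real (Suc k)) m i / real (Suc k) \<and>
     grid_tuple (real (Suc k)) m i / real (Suc k) \<le> m i + 1 / real (Suc k)" for k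
  proof -
    let ?q = "real (Suc k)"
    have "(?q * m i - 1) / ?q \<le> grid_tuple ?q m i / ?q" "grid_tuple ?q m i / ?q \<le> (?q * m i + 1) / ?q"
      using bound[of ?q] by (intro divide_right_mono; linarith)+
    then show ?thesis by (simp add: add_divide_distrib diff_divide_distrib del: of_nat_Suc)
  qed
  then show "\<forall>\<^sub>F k in sequentially. m i - 1 / real (Suc k) \<le> grid_tuple (real (Suc k)) m i / real (Suc k)"
    "\<forall>\<^sub>F k in sequentially. grid_tuple (real (Suc k)) m i / real (Suc k) \<le> m i + 1 / real (Suc k)"
    by auto
  have inv: "(\<lambda>k. 1 / real (Suc k)) \<longlonglongrightarrow> 0" by (rule LIMSEQ_Suc[OF lim_1_over_n])
  show "(\<lambda>k. m i - 1 / real (Suc k)) \<longlonglongrightarrow> m i"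
    using tendsto_diff[OF tendsto_const inv] by simp
  show "(\<lambda>k. m i + 1 / real (Suc k)) \<longlonglongrightarrow> m i"
    using tendsto_add[OF tendsto_const inv] by simp
qed

lemma eventually_lattice_chamber_grid_tuple:
  assumes "\<And>i j. i < j \<Longrightarrow> j < N \<Longrightarrow> m j < m i"
  shows "\<forall>\<^sub>F k in sequentially. lattice_chamber N (grid_tuple (real (Suc k)) m)"
proof -
  have "\<forall>\<^sub>F k in sequentially. \<forall>x\<in>index_pairs N.
      0 < (case x of (i, j) \<Rightarrow> grid_tuple (real (Suc k)) m i / real (Suc k)
             - grid_tuple (real (Suc k)) m j / real (Suc k))"
  proof (intro eventually_ball_finite finite_index_pairs ballI)
    fix x assume x: "x \<in> index_pairs N"
    obtain i j where e: "x = (i, j)" by force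
    have "0 < m i - m j" using x assms by (auto simp: e index_pairs_def)
    then show "\<forall>\<^sub>F k in sequentially. 0 < (case x of (i, j) \<Rightarrow>
        grid_tuple (real (Suc k)) m i / real (Suc k) - grid_tuple (real (Suc k)) m j / real (Suc k))"
      unfolding e prod.case
      by (rule order_tendstoD(1)[OF tendsto_diff[OF tendsto_grid_tuple tendsto_grid_tuple]])
  qed
  then show ?thesis
  proof eventually_elim
    case (elim k)
    have "grid_tuple (real (Suc k)) m j < grid_tuple (real (Suc k)) m i" if "i < j" "j < N" for i j
    proof -
      have "(i, j) \<in> index_pairs N" using that by (simp add: index_pairs_def)
      from bspec[OF elim this]
      have "0 < grid_tuple (real (Suc k)) m i / real (Suc k) - grid_tuple (real (Suc k)) m j / real (Suc k)"
        by (simp only: prod.case)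
      then have "grid_tuple (real (Suc k)) m j / real (Suc k) < grid_tuple (real (Suc k)) m i / real (Suc k)"
        by linarith
      then show ?thesis by (simp add: divide_less_cancel del: of_nat_Suc)
    qed
    then show ?case by (simp add: lattice_chamber_def grid_tuple_def)
  qed
qed

text \<open>Apply the lattice result to the rounded tuples with bases \<open>u i powr (1 / q)\<close> and let \<open>q\<close> tend to
  infinity. The powers of \<open>q\<close> from the two Vandermonde products cancel.\<close>

lemma abs_ratio_mono:
  assumes u: "\<And>i. i < N \<Longrightarrow> 0 < u i"
    and m: "\<And>i j. i < j \<Longrightarrow> j < N \<Longrightarrow> m j < m i"
    and n: "\<And>i j. i < j \<Longrightarrow> j < N \<Longrightarrow> n j < n i"
    and dom: "dominates N m n"
  shows "\<bar>alternant N u n\<bar> / \<bar>vprod N n\<bar> \<le> \<bar>alternant N u m\<bar> / \<bar>vprod N m\<bar>"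
proof -
  define s where "s = (\<lambda>k (x :: nat \<Rightarrow> real) i. grid_tuple (real (Suc k)) x i / real (Suc k))"
  define Q where "Q = (\<lambda>x. \<bar>alternant N u x\<bar> / \<bar>vprod N x\<bar>)"
  have lim: "(\<lambda>k. Q (s k x)) \<longlonglongrightarrow> Q x"
    if x: "\<And>i j. i < j \<Longrightarrow> j < N \<Longrightarrow> x j < x i" for x
  proof -
    have "inj_on x {..<N}" using x unfolding inj_on_def by (metis lessThan_iff less_irrefl nat_neq_iff)
    then have nz: "vprod N x \<noteq> 0" by (simp add: vprod_eq_0_iff)
    have sx: "(\<lambda>k. s k x i) \<longlonglongrightarrow> x i" for i unfolding s_def by (rule tendsto_grid_tuple)
    have V: "(\<lambda>k. vprod N (s k x)) \<longlonglongrightarrow> vprod N x"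
      unfolding vprod_def split_beta by (intro tendsto_intros sx)
    have pw: "(\<lambda>k. u i powr s k x j) \<longlonglongrightarrow> u i powr x j" if "i < N" for i j
      using u[OF that] by (intro tendsto_powr sx tendsto_const) auto
    have "(\<lambda>k. alternant N u (s k x)) \<longlonglongrightarrow> alternant N u x"
      unfolding alternant_def by (intro tendsto_sum tendsto_mult tendsto_const tendsto_prod pw) simp
    then show ?thesis unfolding Q_def by (intro tendsto_intros V) (use nz in auto)
  qed
  have scale: "\<bar>alternant N (\<lambda>i. u i powr (1 / q)) x\<bar> / \<bar>vprod N x\<bar> =
      Q (\<lambda>i. x i / q) / q ^ card (index_pairs N)" if "0 < q" for q x
  proof -
    have "alternant N (\<lambda>i. u i powr (1 / q)) x = alternant N u (\<lambda>i. x i / q)"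
      unfolding alternant_def by (simp add: powr_powr)
    moreover have "vprod N x = q ^ card (index_pairs N) * vprod N (\<lambda>i. x i / q)"
    proof -
      have "vprod N x = (\<Prod>y\<in>index_pairs N. q * (case y of (i, j) \<Rightarrow> x j / q - x i / q))"
        unfolding vprod_def using that by (intro prod.cong refl) (auto simp: field_simps)
      then show ?thesis by (simp add: prod.distrib vprod_def)
    qed
    ultimately show ?thesis using that by (simp add: Q_def abs_mult power_abs)
  qed
  have "\<forall>\<^sub>F k in sequentially. lattice_chamber N (grid_tuple (real (Suc k)) m)"
    "\<forall>\<^sub>F k in sequentially. lattice_chamber N (grid_tuple (real (Suc k)) n)"
    using m n by (blast intro: eventually_lattice_chamber_grid_tuple)+
  then have "\<forall>\<^sub>F k in sequentially. Q (s k n) \<le> Q (s k m)"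
  proof eventually_elim
    case (elim k)
    let ?q = "real (Suc k)"
    have "0 < u i powr (1 / ?q)" if "i < N" for i using u[OF that] by simp
    from lattice_abs_ratio_mono[OF this elim dominates_grid_tuple[OF dom]]
    have "Q (s k n) / ?q ^ card (index_pairs N) \<le> Q (s k m) / ?q ^ card (index_pairs N)"
      unfolding s_def scale[symmetric] by (simp add: scale[symmetric] del: of_nat_Suc)
    then show ?case by (simp add: divide_le_cancel)
  qed
  moreover have "(\<lambda>k. Q (s k m)) \<longlonglongrightarrow> Q m" "(\<lambda>k. Q (s k n)) \<longlonglongrightarrow> Q n"
    using m n by (blast intro: lim)+
  ultimately have "Q n \<le> Q m" by (intro tendsto_le[OF sequentially_bot])
  then show ?thesis by (simp add: Q_def)
qed

section \<open>Growth along geometric curves\<close>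

text \<open>After subtraction of the threshold \<open>\<theta> = b (k - 1)\<close>, entries with index below \<open>k\<close> are nonnegative and
  the others nonpositive, so the initial segment has the largest sum.\<close>

lemma sum_permuted_initial_le:
  fixes b :: "nat \<Rightarrow> real"
  assumes b: "\<And>i j. i < j \<Longrightarrow> j < N \<Longrightarrow> b j \<le> b i"
    and p: "p permutes {..<N}" and k: "k \<le> N"
  shows "(\<Sum>i<k. b (p i)) \<le> (\<Sum>i<k. b i)"
proof -
  define \<theta> where "\<theta> = b (k - 1)"
  let ?L = "{i. i < k \<and> p i < k}"
  have pN: "p i < N" if "i < N" for i using permutes_in_image[OF p, of i] that by simp
  have "(\<Sum>i<k. b (p i) - \<theta>) \<le> (\<Sum>i<k. if p i < k then b (p i) - \<theta> else 0)"
  proof (rule sum_mono)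
    fix i assume "i \<in> {..<k}"
    then show "b (p i) - \<theta> \<le> (if p i < k then b (p i) - \<theta> else 0)"
      using b[of "k - 1" "p i"] pN[of i] k unfolding \<theta>_def by auto
  qed
  also have "\<dots> = (\<Sum>i\<in>?L. b (p i) - \<theta>)"
    by (simp add: sum.If_cases) (simp add: Int_def conj_commute)
  also have "\<dots> = (\<Sum>i\<in>p ` ?L. b i - \<theta>)"
    using permutes_inj[OF p] by (subst sum.reindex) (auto intro: inj_on_subset)
  also have "\<dots> \<le> (\<Sum>i<k. b i - \<theta>)"
  proof (rule sum_mono2)
    fix i assume "i \<in> {..<k} - p ` ?L"
    then have "i = k - 1 \<or> i < k - 1" "k > 0" by auto
    then show "0 \<le> b i - \<theta>" using b[of i "k - 1"] k unfolding \<theta>_def by auto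
  qed auto
  finally show ?thesis by (simp add: sum_subtractf)
qed

text \<open>In the summation by parts all terms are nonnegative, and the term just after the first index moved by
  \<open>p\<close> is positive.\<close>

lemma rearrangement_strict:
  fixes r b :: "nat \<Rightarrow> real"
  assumes r: "\<And>i j. i < j \<Longrightarrow> j < N \<Longrightarrow> r j < r i"
    and b: "\<And>i j. i < j \<Longrightarrow> j < N \<Longrightarrow> b j < b i"
    and p: "p permutes {..<N}" "p \<noteq> id"
  shows "(\<Sum>i<N. r i * b (p i)) < (\<Sum>i<N. r i * b i)"
proof -
  define d where "d = (\<lambda>i. b i - b (p i))"
  define i0 where "i0 = (LEAST i. p i \<noteq> i)"
  have ex: "\<exists>i. p i \<noteq> i" using p(2) by auto
  have i0: "p i0 \<noteq> i0" unfolding i0_def using ex by (rule LeastI_ex)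
  have before: "p i = i" if "i < i0" for i using not_less_Least that unfolding i0_def by blast
  have "p i0 > i0"
  proof (rule ccontr)
    assume "\<not> i0 < p i0"
    then have "p (p i0) = p i0" using before[of "p i0"] i0 by simp
    then show False using permutes_inj[OF p(1)] i0 by (auto dest: injD)
  qed
  moreover have i0N: "i0 < N"
    using permutes_not_in[OF p(1), of i0] i0 by auto
  then have "p i0 < N" using permutes_in_image[OF p(1), of i0] by simp
  ultimately have k0: "Suc i0 \<in> {1..<N}" "b (p i0) < b i0" using b by auto
  have nonneg: "0 \<le> (r (k - 1) - r k) * sum d {..<k}" if "k \<in> {1..<N}" for k
  proof -
    have "(\<Sum>i<k. b (p i)) \<le> (\<Sum>i<k. b i)"
      using that by (intro sum_permuted_initial_le[OF _ p(1)]) (auto intro: less_imp_le b)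
    then show ?thesis using r[of "k - 1" k] that by (simp add: d_def sum_subtractf)
  qed
  have "sum d {..<i0} = 0" unfolding d_def using before by (intro sum.neutral) auto
  then have "0 < (r (Suc i0 - 1) - r (Suc i0)) * sum d {..<Suc i0}"
    using k0 r[of i0 "Suc i0"] by (simp add: d_def)
  then have "0 < (\<Sum>k\<in>{1..<N}. (r (k - 1) - r k) * sum d {..<k})"
    using nonneg k0 by (intro sum_pos2[of _ "Suc i0"]) auto
  moreover have "sum d {..<N} = 0"
    using sum.permute[OF p(1), of b] by (simp add: d_def sum_subtractf o_def)
  ultimately have "0 < (\<Sum>i<N. r i * d i)" unfolding sum_mult_by_partial_sums by simp
  then show ?thesis by (simp add: d_def sum_subtractf right_diff_distrib)
qed

text \<open>Along these curves every term of the Leibniz expansion is a geometric sequence in \<open>l\<close>, and by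
  \<open>rearrangement_strict\<close> the identity permutation has the unique largest ratio.\<close>

lemma alternant_geometric_asymptotics:
  fixes r b :: "nat \<Rightarrow> real"
  assumes B: "1 < B"
    and r: "\<And>i j. i < j \<Longrightarrow> j < N \<Longrightarrow> r j < r i"
    and b: "\<And>i j. i < j \<Longrightarrow> j < N \<Longrightarrow> b j < b i"
  shows "(\<lambda>l. alternant N (\<lambda>i. B powr (real l * r i)) b / B powr (real l * (\<Sum>i<N. r i * b i))) \<longlonglongrightarrow> 1"
proof -
  let ?P = "{p. p permutes {..<N}}"
  define R where "R = (\<lambda>p. \<Sum>i<N. r i * b (p i))"
  have fin: "finite ?P" by (simp add: finite_permutations)
  have eq: "alternant N (\<lambda>i. B powr (real l * r i)) b / B powr (real l * R id) =
      (\<Sum>p\<in>?P. of_int (sign p) * (B powr (R p - R id)) ^ l)" for l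
  proof -
    have "(\<Prod>i<N. (B powr (real l * r i)) powr b (p i)) = B powr (real l * R p)" for p
    proof -
      have "(\<Prod>i<N. (B powr (real l * r i)) powr b (p i)) = (\<Prod>i<N. B powr (real l * (r i * b (p i))))"
        by (simp add: powr_powr mult.assoc)
      also have "\<dots> = B powr (real l * R p)"
        using B by (simp add: R_def powr_sum sum_distrib_left)
      finally show ?thesis .
    qed
    moreover have "B powr (real l * R p) / B powr (real l * R id) = (B powr (R p - R id)) ^ l" for p
      using B by (simp add: powr_diff[symmetric] powr_power right_diff_distrib mult.commute)
    ultimately show ?thesis
      unfolding alternant_def by (simp add: sum_divide_distrib times_divide_eq_right[symmetric]
        del: times_divide_eq_right)
  qed
  have "(\<lambda>l. of_int (sign p) * (B powr (R p - R id)) ^ l) \<longlonglongrightarrow> (if p = id then 1 else 0)"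
    if p: "p \<in> ?P" for p
  proof (cases "p = id")
    case False
    then have "R p < R id" unfolding R_def using rearrangement_strict[of N r b p] r b p by simp
    then have "B powr (R p - R id) < B powr 0" using B by (intro powr_less_mono) auto
    then have "(\<lambda>l. (B powr (R p - R id)) ^ l) \<longlonglongrightarrow> 0" using B by (intro LIMSEQ_power_zero) auto
    then show ?thesis using False tendsto_mult_right_zero by auto
  qed (use B in simp)
  then have "(\<lambda>l. \<Sum>p\<in>?P. of_int (sign p) * (B powr (R p - R id)) ^ l) \<longlonglongrightarrow> (\<Sum>p\<in>?P. if p = id then 1 else 0)"
    by (intro tendsto_sum)
  moreover have "(\<Sum>p\<in>?P. if p = id then 1 else 0) = (1 :: real)"
    using fin permutes_id by (simp add: sum.delta)
  moreover have "R id = (\<Sum>i<N. r i * b i)" by (simp add: R_def)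
  ultimately show ?thesis unfolding eq[symmetric] by simp
qed

text \<open>If the exponent of \<open>b\<close> were larger, division by its power of \<open>B\<close> would send the side of \<open>a\<close> to zero
  while the side of \<open>b\<close> stays bounded away from it. The shift \<open>Suc l\<close> leaves out \<open>l = 0\<close>, where the
  curve passes through the point with all coordinates one, however \<open>r\<close> is chosen.\<close>

lemma exponent_le_of_ratio_le:
  fixes r a b :: "nat \<Rightarrow> real"
  assumes B: "1 < B"
    and r: "\<And>i j. i < j \<Longrightarrow> j < N \<Longrightarrow> r j < r i"
    and a: "\<And>i j. i < j \<Longrightarrow> j < N \<Longrightarrow> a j < a i"
    and b: "\<And>i j. i < j \<Longrightarrow> j < N \<Longrightarrow> b j < b i"
    and le: "\<And>l. \<bar>alternant N (\<lambda>i. B powr (real (Suc l) * r i)) b\<bar> / \<bar>vprod N b\<bar>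
        \<le> \<bar>alternant N (\<lambda>i. B powr (real (Suc l) * r i)) a\<bar> / \<bar>vprod N a\<bar>"
  shows "(\<Sum>i<N. r i * b i) \<le> (\<Sum>i<N. r i * a i)"
proof (rule ccontr)
  define Ra where "Ra = (\<Sum>i<N. r i * a i)"
  define Rb where "Rb = (\<Sum>i<N. r i * b i)"
  define A where "A = (\<lambda>x l. alternant N (\<lambda>i. B powr (real l * r i)) x)"
  assume "\<not> (\<Sum>i<N. r i * b i) \<le> (\<Sum>i<N. r i * a i)"
  then have lt: "Ra < Rb" by (simp add: Ra_def Rb_def)
  have "inj_on b {..<N}" using b unfolding inj_on_def by (metis lessThan_iff less_irrefl nat_neq_iff)
  then have nz: "vprod N b \<noteq> 0" by (simp add: vprod_eq_0_iff)
  have limb: "(\<lambda>l. \<bar>A b l / B powr (real l * Rb)\<bar> / \<bar>vprod N b\<bar>) \<longlonglongrightarrow> \<bar>1\<bar> / \<bar>vprod N b\<bar>"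
    unfolding A_def Rb_def
    by (intro tendsto_intros alternant_geometric_asymptotics[where N = N and r = r and b = b, OF B r b]) (use nz in auto)
  have "B powr (Ra - Rb) < B powr 0" using B lt by (intro powr_less_mono) auto
  then have z: "(\<lambda>l. (B powr (Ra - Rb)) ^ l) \<longlonglongrightarrow> 0" using B by (intro LIMSEQ_power_zero) auto
  have "(\<lambda>l. \<bar>A a l / B powr (real l * Ra)\<bar> * (B powr (Ra - Rb)) ^ l * (1 / \<bar>vprod N a\<bar>))
      \<longlonglongrightarrow> \<bar>1\<bar> * 0 * (1 / \<bar>vprod N a\<bar>)"
    unfolding A_def Ra_def
    by (intro tendsto_intros alternant_geometric_asymptotics[where N = N and r = r and b = a, OF B r a] z[unfolded Ra_def])
  moreover have "\<bar>A a l / B powr (real l * Ra)\<bar> * (B powr (Ra - Rb)) ^ l * (1 / \<bar>vprod N a\<bar>) =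
      \<bar>A a l / B powr (real l * Rb)\<bar> / \<bar>vprod N a\<bar>" for l
  proof -
    have "(B powr (Ra - Rb)) ^ l = B powr (real l * Ra) / B powr (real l * Rb)"
      using B by (simp add: powr_diff[symmetric] powr_power right_diff_distrib mult.commute)
    then show ?thesis using B by (simp add: abs_mult)
  qed
  ultimately have lima: "(\<lambda>l. \<bar>A a l / B powr (real l * Rb)\<bar> / \<bar>vprod N a\<bar>) \<longlonglongrightarrow> 0" by simp
  have "\<bar>A b (Suc l) / B powr (real (Suc l) * Rb)\<bar> / \<bar>vprod N b\<bar>
      \<le> \<bar>A a (Suc l) / B powr (real (Suc l) * Rb)\<bar> / \<bar>vprod N a\<bar>" for l
  proof -
    have "\<bar>A b (Suc l)\<bar> / \<bar>vprod N b\<bar> / B powr (real (Suc l) * Rb)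
        \<le> \<bar>A a (Suc l)\<bar> / \<bar>vprod N a\<bar> / B powr (real (Suc l) * Rb)"
      unfolding A_def by (intro divide_right_mono le) auto
    then show ?thesis using B by (simp add: mult.commute)
  qed
  then have "\<bar>1\<bar> / \<bar>vprod N b\<bar> \<le> (0 :: real)"
    by (intro LIMSEQ_le[OF LIMSEQ_Suc[OF limb] LIMSEQ_Suc[OF lima]]) blast
  then show False using nz by (simp add: divide_le_0_iff)
qed

section \<open>Sorting the exponents\<close>

lemma decr_entry_permutation:
  assumes v: "v \<in> carrier_vec N"
  obtains p where "p permutes {..<N}" "\<And>i. i < N \<Longrightarrow> decr_entry v (Suc i) = v $ p i"
proof -
  let ?xs = "list_of_vec v"
  have len: "length ?xs = N" using v by simp
  have "mset (rev (sort ?xs)) = mset ?xs" by simp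
  then obtain p where p: "p permutes {..<length ?xs}" "permute_list p ?xs = rev (sort ?xs)"
    by (rule mset_eq_permutation)
  show thesis
  proof (rule that)
    show "p permutes {..<N}" using p len by simp
    show "decr_entry v (Suc i) = v $ p i" if "i < N" for i
      using permute_list_nth[OF p(1), of i] that len
      unfolding p(2) decr_entry_def by (simp add: list_of_vec_index)
  qed
qed

lemma decr_entry_strict:
  assumes v: "v \<in> distinct_tuples N" and ij: "i < j" "j < N"
  shows "decr_entry v (Suc j) < decr_entry v (Suc i)"
proof -
  define ys where "ys = rev (sort (list_of_vec v))"
  have len: "length ys = N" using v by (simp add: ys_def distinct_tuples_def)
  have "sorted_wrt (\<ge>) ys" by (simp add: ys_def sorted_wrt_rev)
  then have "ys ! j \<le> ys ! i" using ij len sorted_wrt_nth_less[of "(\<ge>)" ys i j] by simp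
  moreover have "distinct (list_of_vec v)"
    using v by (auto simp: distinct_conv_nth list_of_vec_index distinct_tuples_def)
  then have "distinct ys" by (simp add: ys_def)
  then have "ys ! j \<noteq> ys ! i" using ij len nth_eq_iff_index_eq[of ys i j] by simp
  ultimately show ?thesis unfolding decr_entry_def ys_def[symmetric] by simp
qed

lemma abs_vandermonde_eq:
  assumes v: "v \<in> distinct_tuples N"
  shows "\<bar>vandermonde v\<bar> = \<bar>vprod N (\<lambda>i. decr_entry v (Suc i))\<bar>"
proof -
  have "v \<in> carrier_vec N" using v by (simp add: distinct_tuples_def)
  then obtain p where p: "p permutes {..<N}" "\<And>i. i < N \<Longrightarrow> decr_entry v (Suc i) = v $ p i"
    by (rule decr_entry_permutation) blast
  have "vprod N (\<lambda>i. decr_entry v (Suc i)) = vprod N (($) v \<circ> p)"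
    unfolding vprod_def using p(2) by (intro prod.cong refl) (auto simp: index_pairs_def)
  also have "\<dots> = of_int (sign p) * vandermonde v"
    unfolding vprod_permutation[OF p(1)] using carrier_vecD[OF \<open>v \<in> carrier_vec N\<close>]
    by (simp add: vandermonde_def vprod_def index_pairs_def)
  finally show ?thesis by (simp add: abs_mult sign_def)
qed

lemma abs_det_gen_vandermonde_mat_eq:
  assumes v: "v \<in> distinct_tuples N" and u: "u \<in> carrier_vec N"
  shows "\<bar>det (gen_vandermonde_mat u v)\<bar> = \<bar>alternant N (($) u) (\<lambda>i. decr_entry v (Suc i))\<bar>"
proof -
  have "v \<in> carrier_vec N" using v by (simp add: distinct_tuples_def)
  then obtain p where p: "p permutes {..<N}" "\<And>i. i < N \<Longrightarrow> decr_entry v (Suc i) = v $ p i"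
    by (rule decr_entry_permutation) blast
  have dim: "dim_vec v = N" "dim_vec u = N" using u v by (auto simp: distinct_tuples_def)
  have carrier: "gen_vandermonde_mat u v \<in> carrier_mat N N"
    unfolding gen_vandermonde_mat_def using dim mat_of_cols_carrier(1)[of N "map (hadamard_powr u) (list_of_vec v)"]
    by simp
  have entry: "gen_vandermonde_mat u v $$ (i, j) = u $ i powr v $ j" if "i < N" "j < N" for i j
    using that dim by (simp add: gen_vandermonde_mat_def mat_of_cols_index hadamard_powr_def list_of_vec_index)
  have im: "q i < N" if "q permutes {..<N}" "i < N" for q i
    using permutes_in_image[OF that(1), of i] that(2) by simp
  have det: "det (gen_vandermonde_mat u v) = alternant N (($) u) (($) v)"
    unfolding det_def'[OF carrier] alternant_def lessThan_atLeast0[symmetric]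
    by (intro sum.cong refl arg_cong2[where f = "(*)"] prod.cong) (auto simp: entry im)
  have "alternant N (($) u) (($) v) = (\<Sum>q | q permutes {..<N}.
      of_int (sign (p \<circ> q)) * (\<Prod>i<N. u $ i powr v $ ((p \<circ> q) i)))"
    unfolding alternant_def by (rule setum_permutations_compose_left[OF p(1)])
  also have "\<dots> = (\<Sum>q | q permutes {..<N}. of_int (sign p) *
      (of_int (sign q) * (\<Prod>i<N. u $ i powr decr_entry v (Suc (q i)))))"
  proof (intro sum.cong refl)
    fix q assume "q \<in> {q. q permutes {..<N}}"
    then have q: "q permutes {..<N}" by simp
    have "sign (p \<circ> q) = sign p * sign q"
      using p(1) q by (intro sign_compose permutes_imp_permutation[of "{..<N}"]) auto
    moreover have "(\<Prod>i<N. u $ i powr v $ ((p \<circ> q) i)) = (\<Prod>i<N. u $ i powr decr_entry v (Suc (q i)))"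
      using p(2) im[OF q] by (intro prod.cong refl) simp
    ultimately show "of_int (sign (p \<circ> q)) * (\<Prod>i<N. u $ i powr v $ ((p \<circ> q) i)) =
       of_int (sign p) * (of_int (sign q) * (\<Prod>i<N. u $ i powr decr_entry v (Suc (q i))))"
      by (simp only: of_int_mult mult.assoc)
  qed
  also have "\<dots> = of_int (sign p) * alternant N (($) u) (\<lambda>i. decr_entry v (Suc i))"
    unfolding alternant_def sum_distrib_left ..
  finally show ?thesis unfolding det by (simp add: abs_mult sign_def)
qed

lemma vdm_ratio_ineq_iff:
  assumes "m \<in> distinct_tuples N" "n \<in> distinct_tuples N" "u \<in> carrier_vec N"
  shows "vdm_ratio_ineq m n u \<longleftrightarrow>
    \<bar>alternant N (($) u) (\<lambda>i. decr_entry n (Suc i))\<bar> / \<bar>vprod N (\<lambda>i. decr_entry n (Suc i))\<bar> \<le>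
    \<bar>alternant N (($) u) (\<lambda>i. decr_entry m (Suc i))\<bar> / \<bar>vprod N (\<lambda>i. decr_entry m (Suc i))\<bar>"
  using assms by (simp add: vdm_ratio_ineq_def abs_vandermonde_eq abs_det_gen_vandermonde_mat_eq)

lemma majorizes_iff_dominates:
  assumes "m \<in> distinct_tuples N" "n \<in> distinct_tuples N"
  shows "majorizes m n \<longleftrightarrow> dominates N (\<lambda>i. decr_entry m (Suc i)) (\<lambda>i. decr_entry n (Suc i))"
proof -
  have shift: "(\<Sum>j = 1..k. f j) = (\<Sum>i<k. f (Suc i))" for f :: "nat \<Rightarrow> real" and k
    using sum.atLeast1_atMost_eq[of f k] by simp
  have dim: "dim_vec m = N" "dim_vec n = N" using assms by (auto simp: distinct_tuples_def)
  have zero: "sum g {..<k} \<le> sum f {..<k}" if "\<not> 0 < k" for k and f g :: "nat \<Rightarrow> real"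
    using that by simp
  show ?thesis
  proof
    assume "majorizes m n"
    then show "dominates N (\<lambda>i. decr_entry m (Suc i)) (\<lambda>i. decr_entry n (Suc i))"
      unfolding majorizes_def dominates_def dim shift using zero by metis
  next
    assume "dominates N (\<lambda>i. decr_entry m (Suc i)) (\<lambda>i. decr_entry n (Suc i))"
    then show "majorizes m n" unfolding majorizes_def dominates_def dim shift by simp
  qed
qed

lemma majorizes_imp_ineq:
  assumes mn: "m \<in> distinct_tuples N" "n \<in> distinct_tuples N" and maj: "majorizes m n"
    and u: "u \<in> vec_cube {0<..} N"
  shows "vdm_ratio_ineq m n u"
proof -
  have "u \<in> carrier_vec N" "\<And>i. i < N \<Longrightarrow> 0 < u $ i" using u by (auto simp: vec_cube_def)
  then show ?thesis
    unfolding vdm_ratio_ineq_iff[OF mn \<open>u \<in> carrier_vec N\<close>]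
    using maj[unfolded majorizes_iff_dominates[OF mn]] mn
    by (intro abs_ratio_mono) (auto intro: decr_entry_strict)
qed

lemma le_of_multiples_le:
  fixes x y s t :: real
  assumes "\<And>c :: nat. real c * x + s \<le> real c * y + t"
  shows "x \<le> y"
proof (rule ccontr)
  assume "\<not> x \<le> y"
  then obtain c :: nat where "t - s < real c * (x - y)"
    using ex_less_of_nat_mult[of "x - y" "t - s"] by auto
  then show False using assms[of c] by (simp add: algebra_simps)
qed

section \<open>A countable test set\<close>

text \<open>The parameter \<open>c\<close> puts emphasis on the first \<open>k\<close> coordinates, so that growth rates see the \<open>k\<close>-th
  partial sum; the term \<open>N - i\<close> keeps the exponents positive and strictly decreasing.\<close>

definition rays_to_infinity :: "real \<Rightarrow> nat \<Rightarrow> real vec set" where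
  "rays_to_infinity B N = (\<lambda>(l, c, k). vec N (\<lambda>i. B powr (real (Suc l) *
     (real c * (if i < k then 1 else 0) + real (N - i))))) ` (UNIV :: (nat \<times> nat \<times> nat) set)"

text \<open>Here \<open>c\<close> weighs all coordinates equally and negatively, which detects the reverse inequality of the
  totals.\<close>

definition rays_to_zero :: "real \<Rightarrow> nat \<Rightarrow> real vec set" where
  "rays_to_zero B N = (\<lambda>(l, c). vec N (\<lambda>i. B powr (real (Suc l) *
     - (real c + real (Suc i))))) ` (UNIV :: (nat \<times> nat) set)"

lemma rays_to_infinity_subset:
  assumes "1 < B" "{B..} \<subseteq> I"
  shows "rays_to_infinity B N \<subseteq> vec_cube I N"
proof -
  have "B powr (real (Suc l) * (real c * (if i < k then 1 else 0) + real (N - i))) \<in> I"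
    if "i < N" for l c k i
  proof -
    have "1 * 1 \<le> real (Suc l) * (real c * (if i < k then 1 else 0) + real (N - i))"
      using that by (intro mult_mono) auto
    then have "B powr 1 \<le> B powr (real (Suc l) * (real c * (if i < k then 1 else 0) + real (N - i)))"
      using assms by (intro powr_mono) auto
    then show ?thesis using assms by auto
  qed
  then show ?thesis by (auto simp: rays_to_infinity_def vec_cube_def)
qed

lemma rays_to_zero_subset:
  assumes "1 < B" "{0<..1 / B} \<subseteq> I"
  shows "rays_to_zero B N \<subseteq> vec_cube I N"
proof -
  have "B powr (real (Suc l) * - (real c + real (Suc i))) \<in> I" for l c i
  proof -
    have "1 * 1 \<le> real (Suc l) * (real c + real (Suc i))" by (intro mult_mono) auto
    then have "B powr (real (Suc l) * - (real c + real (Suc i))) \<le> B powr (- 1)"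
      unfolding mult_minus_right using assms(1) by (intro powr_mono) linarith+
    then show ?thesis using assms by (auto simp: powr_minus_divide)
  qed
  then show ?thesis by (auto simp: rays_to_zero_def vec_cube_def)
qed

lemma ineq_on_rays_imp_majorizes:
  assumes mn: "m \<in> distinct_tuples N" "n \<in> distinct_tuples N" and B: "1 < B"
    and ineq: "\<forall>u \<in> rays_to_infinity B N \<union> rays_to_zero B N. vdm_ratio_ineq m n u"
  shows "majorizes m n"
proof -
  define a where "a = (\<lambda>i. decr_entry m (Suc i))"
  define b where "b = (\<lambda>i. decr_entry n (Suc i))"
  have a: "a j < a i" and b: "b j < b i" if "i < j" "j < N" for i j
    using decr_entry_strict[OF mn(1) that] decr_entry_strict[OF mn(2) that]
    by (simp_all add: a_def b_def)
  have main: "(\<Sum>i<N. r i * b i) \<le> (\<Sum>i<N. r i * a i)"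
    if r: "\<And>i j. i < j \<Longrightarrow> j < N \<Longrightarrow> r j < r i"
      and mem: "\<And>l. vec N (\<lambda>i. B powr (real (Suc l) * r i)) \<in> rays_to_infinity B N \<union> rays_to_zero B N"
    for r
  proof (rule exponent_le_of_ratio_le[where N = N and r = r and a = a and b = b, OF B r a b])
    fix l
    let ?u = "\<lambda>i. B powr (real (Suc l) * r i)"
    have alt: "alternant N (($) (vec N ?u)) x = alternant N ?u x" for x
      unfolding alternant_def by simp
    have "vdm_ratio_ineq m n (vec N ?u)" using ineq mem by blast
    then show "\<bar>alternant N ?u b\<bar> / \<bar>vprod N b\<bar> \<le> \<bar>alternant N ?u a\<bar> / \<bar>vprod N a\<bar>"
      unfolding vdm_ratio_ineq_iff[OF mn vec_carrier] alt a_def b_def .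
  qed auto
  have le: "sum b {..<k} \<le> sum a {..<k}" if k: "k \<le> N" for k
  proof (rule le_of_multiples_le)
    fix c :: nat
    let ?r = "\<lambda>i. real c * (if i < k then 1 else 0) + real (N - i)"
    have "(\<Sum>i<N. ?r i * b i) \<le> (\<Sum>i<N. ?r i * a i)"
    proof (rule main)
      fix i j assume "i < j" "j < N"
      then show "?r j < ?r i" by (intro add_le_less_mono mult_left_mono) auto
    next
      fix l
      show "vec N (\<lambda>i. B powr (real (Suc l) * ?r i)) \<in> rays_to_infinity B N \<union> rays_to_zero B N"
        unfolding rays_to_infinity_def by (intro UnI1 image_eqI[of _ _ "(l, c, k)"]) simp_all
    qed
    moreover have "(\<Sum>i<N. ?r i * x i) = real c * sum x {..<k} + (\<Sum>i<N. real (N - i) * x i)" for x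
    proof -
      have "(\<Sum>i<N. (if i < k then 1 else 0) * x i) = sum x {..<k}"
        using k by (intro sum.mono_neutral_cong_right) auto
      then show ?thesis
        by (simp add: distrib_right sum.distrib mult.assoc sum_distrib_left[symmetric])
    qed
    ultimately show "real c * sum b {..<k} + (\<Sum>i<N. real (N - i) * b i) \<le>
      real c * sum a {..<k} + (\<Sum>i<N. real (N - i) * a i)" by simp
  qed
  have "- sum b {..<N} \<le> - sum a {..<N}"
  proof (rule le_of_multiples_le)
    fix c :: nat
    let ?r = "\<lambda>i. - (real c + real (Suc i))"
    have "(\<Sum>i<N. ?r i * b i) \<le> (\<Sum>i<N. ?r i * a i)"
      by (rule main) (auto simp: rays_to_zero_def)
    moreover have "(\<Sum>i<N. ?r i * x i) = real c * - sum x {..<N} + (\<Sum>i<N. - real (Suc i) * x i)" for x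
      by (simp add: distrib_right left_diff_distrib sum.distrib sum_subtractf sum_negf sum_distrib_left)
    ultimately show "real c * - sum b {..<N} + (\<Sum>i<N. - real (Suc i) * b i) \<le>
      real c * - sum a {..<N} + (\<Sum>i<N. - real (Suc i) * a i)" by simp
  qed
  then have "dominates N a b" using le by (fastforce simp: dominates_def)
  then show ?thesis by (simp add: majorizes_iff_dominates[OF mn] a_def b_def)
qed

lemma ex_countable_test_set:
  assumes I0: "deleted_nbhd_zero I0" and Iinf: "deleted_nbhd_infinity Iinf"
  obtains S where "countable S" "S \<subseteq> vec_cube I0 N \<union> vec_cube Iinf N" "S \<subseteq> vec_cube {0<..} N"
    "\<And>m n. m \<in> distinct_tuples N \<Longrightarrow> n \<in> distinct_tuples N \<Longrightarrow>
      \<forall>u \<in> S. vdm_ratio_ineq m n u \<Longrightarrow> majorizes m n"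
proof -
  obtain K where K: "1 \<le> K" "Iinf = {K<..} \<or> Iinf = {K..}"
    using Iinf by (auto simp: deleted_nbhd_infinity_def)
  obtain \<delta> where \<delta>: "0 < \<delta>" "\<delta> \<le> 1" "I0 = {0<..<\<delta>} \<or> I0 = {0<..\<delta>}"
    using I0 by (auto simp: deleted_nbhd_zero_def)
  define B where "B = K + 1 / \<delta>"
  have "0 < 1 / \<delta>" using \<delta> by simp
  then have B: "1 < B" "K < B" "1 / \<delta> < B" using K unfolding B_def by linarith+
  then have "1 / B < \<delta>" using \<delta> by (simp add: divide_simps mult.commute)
  let ?S = "rays_to_infinity B N \<union> rays_to_zero B N"
  show thesis
  proof (rule that)
    show "countable ?S"
      unfolding rays_to_infinity_def rays_to_zero_def by (intro countable_Un countable_image) auto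
    have "{B..} \<subseteq> Iinf" using K B by auto
    moreover have "{0<..1 / B} \<subseteq> I0" using \<delta> \<open>1 / B < \<delta>\<close> by auto
    ultimately show "?S \<subseteq> vec_cube I0 N \<union> vec_cube Iinf N"
      using rays_to_infinity_subset[OF B(1)] rays_to_zero_subset[OF B(1)] by blast
    have "{B..} \<subseteq> {0<..}" "{0<..1 / B} \<subseteq> {0<..}" using B by auto
    then show "?S \<subseteq> vec_cube {0<..} N"
      using rays_to_infinity_subset[OF B(1)] rays_to_zero_subset[OF B(1)] by blast
    show "majorizes m n" if "m \<in> distinct_tuples N" "n \<in> distinct_tuples N"
      "\<forall>u \<in> ?S. vdm_ratio_ineq m n u" for m n
      using ineq_on_rays_imp_majorizes[OF that(1,2) B(1) that(3)] .
  qed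
qed

theorem theorem1p16:
  fixes N :: nat
  assumes "N > 0"
  shows "(\<forall>m \<in> distinct_tuples N. \<forall>n \<in> distinct_tuples N.
            ((\<forall>u \<in> vec_cube {0<..} N. vdm_ratio_ineq m n u) \<longleftrightarrow> majorizes m n) \<and>
            (majorizes m n \<longleftrightarrow>
              (\<forall>u \<in> vec_cube {0<..<1} N \<union> vec_cube {1<..} N. vdm_ratio_ineq m n u))) \<and>
         (\<forall>I0 Iinf. deleted_nbhd_zero I0 \<and> deleted_nbhd_infinity Iinf \<longrightarrow>
            (\<exists>S. countable S \<and> S \<subseteq> vec_cube I0 N \<union> vec_cube Iinf N \<and>
              (\<forall>m \<in> distinct_tuples N. \<forall>n \<in> distinct_tuples N.
                 ((\<forall>u \<in> vec_cube {0<..} N. vdm_ratio_ineq m n u) \<longleftrightarrow>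
                    (\<forall>u \<in> S. vdm_ratio_ineq m n u)) \<and>
                 (majorizes m n \<longleftrightarrow> (\<forall>u \<in> S. vdm_ratio_ineq m n u)))))"
proof (intro conjI ballI allI impI)
  fix m n assume mn: "m \<in> distinct_tuples N" "n \<in> distinct_tuples N"
  have "deleted_nbhd_zero {0<..<1}" "deleted_nbhd_infinity {1<..}"
    by (auto simp: deleted_nbhd_zero_def deleted_nbhd_infinity_def intro: exI[of _ 1])
  from ex_countable_test_set[OF this, where N = N]
  obtain S where S: "S \<subseteq> vec_cube {0<..<1} N \<union> vec_cube {1<..} N" "S \<subseteq> vec_cube {0<..} N"
    "\<forall>u \<in> S. vdm_ratio_ineq m n u \<Longrightarrow> majorizes m n"
    using mn by metis
  have pos: "vec_cube {0<..<1} N \<union> vec_cube {1<..} N \<subseteq> vec_cube {0<..} N"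
    by (auto simp: vec_cube_def)
  note fwd = majorizes_imp_ineq[OF mn]
  show "(\<forall>u \<in> vec_cube {0<..} N. vdm_ratio_ineq m n u) \<longleftrightarrow> majorizes m n"
    using fwd S(2,3) by blast
  show "majorizes m n \<longleftrightarrow> (\<forall>u \<in> vec_cube {0<..<1} N \<union> vec_cube {1<..} N. vdm_ratio_ineq m n u)"
    using fwd S(1,3) pos by blast
next
  fix I0 Iinf assume "deleted_nbhd_zero I0 \<and> deleted_nbhd_infinity Iinf"
  then obtain S where S: "countable S" "S \<subseteq> vec_cube I0 N \<union> vec_cube Iinf N"
    "S \<subseteq> vec_cube {0<..} N"
    "\<And>m n. m \<in> distinct_tuples N \<Longrightarrow> n \<in> distinct_tuples N \<Longrightarrow>
      \<forall>u \<in> S. vdm_ratio_ineq m n u \<Longrightarrow> majorizes m n"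
    using ex_countable_test_set[of I0 Iinf N] by metis
  show "\<exists>S. countable S \<and> S \<subseteq> vec_cube I0 N \<union> vec_cube Iinf N \<and>
      (\<forall>m \<in> distinct_tuples N. \<forall>n \<in> distinct_tuples N.
         ((\<forall>u \<in> vec_cube {0<..} N. vdm_ratio_ineq m n u) \<longleftrightarrow> (\<forall>u \<in> S. vdm_ratio_ineq m n u)) \<and>
         (majorizes m n \<longleftrightarrow> (\<forall>u \<in> S. vdm_ratio_ineq m n u)))"
  proof (intro exI[of _ S] conjI ballI S(1,2))
    fix m n assume mn: "m \<in> distinct_tuples N" "n \<in> distinct_tuples N"
    note fwd = majorizes_imp_ineq[OF mn] and bwd = S(4)[OF mn]
    show "(\<forall>u \<in> vec_cube {0<..} N. vdm_ratio_ineq m n u) \<longleftrightarrow> (\<forall>u \<in> S. vdm_ratio_ineq m n u)"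
      using fwd bwd S(3) by blast
    show "majorizes m n \<longleftrightarrow> (\<forall>u \<in> S. vdm_ratio_ineq m n u)"
      using fwd bwd S(3) by blast
  qed
qed

end
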